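(* Let $m\ge n$ and let $A\in\{0,1\}^{m\times n}$ be the incidence matrix of a random $k$-regular hypergraph, and let $C\in\{-1,0,1\}^{m\times n}$ be an arbitrary matrix with at most $t$ non-zero entries in each column. Then with probability $1-n^{-\Omega(1)}$, \[\mathrm{disc}(A+C)=O\left(\sqrt{k}+\sqrt{t\log n}\right).\]
   Context: A random $k$-regular hypergraph on $n$ vertices with $m$ edges has incidence matrix $A\in\{0,1\}^{m\times n}$ in which each column independently has $1$'s in $k$ rows chosen uniformly at random (and $0$ elsewhere). For $B\in\mathbb{R}^{m\times n}$, $\mathrm{disc}(B)=\min_{x\in\{-1,1\}^n}\|Bx\|_\infty$. The $O(\cdot)$ and $\Omega(\cdot)$ hide absolute constants. *)

theory Defs
  imports "HOL-Probability.Probability" "Jordan_Normal_Form.Matrix"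
begin

(* The inserted 0 only matters for the vector of dimension 0. *)
definition linf_norm_vec :: "real vec \<Rightarrow> real" where
  "linf_norm_vec v = Max (insert 0 (abs ` vec_set v))"

definition sign_vecs :: "nat \<Rightarrow> real vec set" where
  "sign_vecs n = {x \<in> carrier_vec n. vec_set x \<subseteq> {-1, 1}}"

definition disc :: "real mat \<Rightarrow> real" where
  "disc B = Min ((\<lambda>x. linf_norm_vec (B *\<^sub>v x)) ` sign_vecs (dim_col B))"

(* Min and Max are unspecified on infinite sets, Min also on the empty set. *)

lemma finite_vec_set: "finite (vec_set v)"
  by (simp add: vec_set_def)

lemma finite_sign_vecs: "finite (sign_vecs n)"
proof (rule finite_subset)
  show "sign_vecs n \<subseteq> (\<lambda>f. vec n f) ` ({..<n} \<rightarrow>\<^sub>E {-1, 1})"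
  proof
    fix x :: "real vec"
    assume x: "x \<in> sign_vecs n"
    let ?f = "restrict (vec_index x) {..<n}"
    have d: "dim_vec x = n"
      using x by (auto simp: sign_vecs_def)
    have "x = vec n ?f"
      using d by (intro eq_vecI) auto
    moreover have "vec_index x i \<in> {-1, 1}" if "i < n" for i
      using x that d unfolding sign_vecs_def by (auto simp: vec_set_def)
    then have "?f \<in> {..<n} \<rightarrow>\<^sub>E {-1, 1}"
      by (intro restrict_PiE_iff[THEN iffD2]) auto
    ultimately show "x \<in> (\<lambda>f. vec n f) ` ({..<n} \<rightarrow>\<^sub>E {-1, 1})"
      by blast
  qed
  show "finite ((\<lambda>f. vec n f :: real vec) ` ({..<n} \<rightarrow>\<^sub>E {-1, 1}))"
    by (intro finite_imageI finite_PiE) auto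
qed

lemma sign_vecs_nonempty: "sign_vecs n \<noteq> {}"
proof -
  have "vec n (\<lambda>_. 1) \<in> sign_vecs n"
    by (auto simp: sign_vecs_def vec_set_def)
  then show ?thesis by blast
qed

(* E j is the set of edges (rows) containing vertex (column) j; the sets
   E 0, ..., E (n - 1) are independent uniformly random k-subsets of the m rows.
   pmf_of_set is meaningful only for a nonempty set, i.e. for k \<le> m. *)
definition random_regular_incidence :: "nat \<Rightarrow> nat \<Rightarrow> nat \<Rightarrow> real mat pmf" where
  "random_regular_incidence m n k =
     map_pmf (\<lambda>E. Matrix.mat m n (\<lambda>(i, j). of_bool (i \<in> E j)))
       (Pi_pmf {..<n} {} (\<lambda>_. pmf_of_set {S. S \<subseteq> {..<m} \<and> card S = k}))"

definition col_nonzeros :: "real mat \<Rightarrow> nat \<Rightarrow> nat" where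
  "col_nonzeros C j = card {i. i < dim_row C \<and> C $$ (i, j) \<noteq> 0}"

end

theory Submission
  imports Defs
begin

text \<open>
  Say that the random matrix is spread if, for every set \<open>S\<close> of columns, at most \<open>card S / 16\<close> rows
  have more than \<open>64 (k card S / m + sqrt k)\<close> ones in \<open>S\<close>. A Chernoff bound and a union bound over
  pairs (columns, rows) show that this fails with probability at most \<open>1 / n\<close>.

  For a spread matrix and any \<open>C\<close>, a colouring is found by a deterministic walk in the cube that
  freezes coordinates at \<open>-1\<close> or \<open>1\<close>. Rows that are long on the alive coordinates are kept at their
  current value; there are few of them. The remaining rows are controlled by a potential
  \<open>\<Sum> w exp (a x + 5 \<Sum> a\<^sub>j\<^sup>2 (1 - x\<^sub>j\<^sup>2))\<close>, whose second-order term pays for the movement since the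
  quadratic form \<open>\<Sum> f L\<^sup>2\<close> is dominated by twice its diagonal on a suitable direction.
  Rows of \<open>C\<close> keep one potential during the entire walk, which yields \<open>sqrt (t ln n)\<close> without any
  loss over phases. Rows of \<open>A\<close> start a new potential whenever the number of alive coordinates has
  dropped by a factor 4, until it is \<open>m / sqrt k\<close>; from then on light rows have length
  \<open>O (sqrt k)\<close>.
\<close>

section \<open>Small directions of quadratic forms\<close>

lemma homogeneous_system_nontrivial:
  fixes B :: "('c \<Rightarrow> real) set"
  assumes "finite S" "finite B" "card B < card S"
  shows "\<exists>v. (\<forall>j. j \<notin> S \<longrightarrow> v j = 0) \<and> (\<exists>j\<in>S. v j \<noteq> 0) \<and> (\<forall>b\<in>B. (\<Sum>j\<in>S. b j * v j) = 0)"
proof -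
  have "\<exists>v. (\<forall>j. j \<notin> S \<longrightarrow> v j = 0) \<and> (\<exists>j\<in>S. v j \<noteq> 0) \<and> (\<forall>b\<in>B. (\<Sum>j\<in>S. b j * v j) = 0)"
    if "finite S" "finite B" "card B \<le> k" "k < card S" for k and S :: "'c set" and B :: "('c \<Rightarrow> real) set"
    using that
  proof (induction k arbitrary: S B)
    case 0
    then obtain p where p: "p \<in> S" by fastforce
    have "B = {}" using 0 by simp
    then show ?case using p by (intro exI[of _ "\<lambda>j. if j = p then 1 else 0"]) auto
  next
    case (Suc k)
    show ?case
    proof (cases "B = {}")
      case True
      obtain p where p: "p \<in> S" using Suc.prems by fastforce
      then show ?thesis using True by (intro exI[of _ "\<lambda>j. if j = p then 1 else 0"]) auto
    next
      case nonempty: False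
      then obtain b where b: "b \<in> B" by blast
      define B0 where "B0 = B - {b}"
      have B0: "finite B0" "card B0 \<le> k" "B = insert b B0"
        using Suc.prems b by (auto simp: B0_def)
      show ?thesis
      proof (cases "\<exists>p\<in>S. b p \<noteq> 0")
        case False
        have "\<exists>v. (\<forall>j. j \<notin> S \<longrightarrow> v j = 0) \<and> (\<exists>j\<in>S. v j \<noteq> 0) \<and> (\<forall>b\<in>B0. (\<Sum>j\<in>S. b j * v j) = 0)"
          using Suc.prems B0 by (intro Suc.IH) auto
        then show ?thesis using False B0(3) by auto
      next
        case True
        then obtain p where p: "p \<in> S" "b p \<noteq> 0" by blast
        define S' where "S' = S - {p}"
        define h where "h g = (\<lambda>j. g j - g p / b p * b j)" for g :: "'c \<Rightarrow> real"
        have card: "card (h ` B0) \<le> k" using card_image_le[of B0 h] B0 by simp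
        have S': "finite S'" "card S' > k" "p \<notin> S'" "S = insert p S'"
          using Suc.prems p by (auto simp: S'_def)
        have "\<exists>v. (\<forall>j. j \<notin> S' \<longrightarrow> v j = 0) \<and> (\<exists>j\<in>S'. v j \<noteq> 0) \<and> (\<forall>b\<in>h ` B0. (\<Sum>j\<in>S'. b j * v j) = 0)"
          using Suc.prems B0(1) card S' by (intro Suc.IH) auto
        then obtain v where v: "\<forall>j. j \<notin> S' \<longrightarrow> v j = 0" "\<exists>j\<in>S'. v j \<noteq> 0"
            "\<And>g. g \<in> B0 \<Longrightarrow> (\<Sum>j\<in>S'. h g j * v j) = 0"
          by blast
        define c where "c = - (\<Sum>j\<in>S'. b j * v j) / b p"
        define w where "w = v(p := c)"
        have sum: "(\<Sum>j\<in>S. g j * w j) = g p * c + (\<Sum>j\<in>S'. g j * v j)" for g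
        proof -
          have "(\<Sum>j\<in>S. g j * w j) = g p * w p + (\<Sum>j\<in>S'. g j * w j)"
            using S' by simp
          also have "(\<Sum>j\<in>S'. g j * w j) = (\<Sum>j\<in>S'. g j * v j)"
            using S'(3) by (intro sum.cong) (auto simp: w_def)
          finally show ?thesis by (simp add: w_def)
        qed
        have bz: "(\<Sum>j\<in>S. b j * w j) = 0" unfolding sum c_def using p by simp
        have gz: "(\<Sum>j\<in>S. g j * w j) = 0" if "g \<in> B0" for g
        proof -
          have "0 = (\<Sum>j\<in>S'. h g j * v j)" using v(3)[OF that] by simp
          also have "\<dots> = (\<Sum>j\<in>S'. g j * v j) - g p / b p * (\<Sum>j\<in>S'. b j * v j)"
            by (simp add: h_def algebra_simps sum_subtractf sum_distrib_left)
          also have "\<dots> = (\<Sum>j\<in>S. g j * w j)" unfolding sum c_def by simp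
          finally show ?thesis by simp
        qed
        have "\<forall>j. j \<notin> S \<longrightarrow> w j = 0" using v S' by (auto simp: w_def)
        moreover have "\<exists>j\<in>S. w j \<noteq> 0" using v(2) S' by (auto simp: w_def)
        ultimately show ?thesis using bz gz B0(3) by (intro exI[of _ w]) auto
      qed
    qed
  qed
  from this[OF assms(1,2) order_refl assms(3)] show ?thesis .
qed

lemma orthonormal_system_exists:
  fixes B :: "('c \<Rightarrow> real) set"
  assumes "finite S" "finite B" "r + card B \<le> card S"
  shows "\<exists>U :: ('c \<Rightarrow> real) set. finite U \<and> card U = r \<and>
           (\<forall>u\<in>U. \<forall>j. j \<notin> S \<longrightarrow> u j = 0) \<and>
           (\<forall>u\<in>U. (\<Sum>j\<in>S. u j * u j) = 1) \<and>
           (\<forall>u\<in>U. \<forall>v\<in>U. u \<noteq> v \<longrightarrow> (\<Sum>j\<in>S. u j * v j) = 0) \<and>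
           (\<forall>u\<in>U. \<forall>b\<in>B. (\<Sum>j\<in>S. b j * u j) = 0)"
  using assms(3)
proof (induction r)
  case 0
  show ?case by (intro exI[of _ "{}"]) auto
next
  case (Suc r)
  then obtain U where U: "finite U" "card U = r" "\<forall>u\<in>U. \<forall>j. j \<notin> S \<longrightarrow> u j = 0"
      "\<forall>u\<in>U. (\<Sum>j\<in>S. u j * u j) = 1"
      "\<forall>u\<in>U. \<forall>v\<in>U. u \<noteq> v \<longrightarrow> (\<Sum>j\<in>S. u j * v j) = 0"
      "\<forall>u\<in>U. \<forall>b\<in>B. (\<Sum>j\<in>S. b j * u j) = 0"
    by auto
  have "card (B \<union> U) < card S"
    using card_Un_le[of B U] Suc.prems U(2) by linarith
  then obtain v where v: "\<forall>j. j \<notin> S \<longrightarrow> v j = 0" "\<exists>j\<in>S. v j \<noteq> 0"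
      "\<forall>b\<in>B \<union> U. (\<Sum>j\<in>S. b j * v j) = 0"
    using homogeneous_system_nontrivial[of S "B \<union> U"] assms U by blast
  define q where "q = (\<Sum>j\<in>S. v j * v j)"
  have q: "q > 0"
    unfolding q_def using v(2) assms(1) by (auto intro!: sum_pos2 simp: zero_less_mult_iff)
  define w where "w = (\<lambda>j. v j / sqrt q)"
  have ws: "(\<Sum>j\<in>S. b j * w j) = (\<Sum>j\<in>S. b j * v j) / sqrt q" for b
    by (simp add: w_def sum_divide_distrib)
  have w1: "(\<Sum>j\<in>S. w j * w j) = 1"
  proof -
    have "(\<Sum>j\<in>S. w j * w j) = (\<Sum>j\<in>S. v j * v j / q)"
      using q by (intro sum.cong) (auto simp: w_def)
    then show ?thesis using q by (simp add: q_def flip: sum_divide_distrib)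
  qed
  have wo: "(\<Sum>j\<in>S. u j * w j) = 0" if "u \<in> B \<union> U" for u
    using v(3) that by (simp add: ws)
  have wo': "(\<Sum>j\<in>S. w j * u j) = 0" if "u \<in> U" for u
    using wo[of u] that by (simp add: mult.commute)
  have "w \<notin> U" using wo[of w] w1 by auto
  then show ?case using U v w1 wo wo'
    by (intro exI[of _ "insert w U"]) (auto simp: w_def)
qed

lemma bessel_finite:
  fixes U :: "('c \<Rightarrow> real) set"
  assumes "finite S" "finite U"
    and "\<And>u. u \<in> U \<Longrightarrow> (\<Sum>j\<in>S. u j * u j) = 1"
    and "\<And>u v. u \<in> U \<Longrightarrow> v \<in> U \<Longrightarrow> u \<noteq> v \<Longrightarrow> (\<Sum>j\<in>S. u j * v j) = 0"
  shows "(\<Sum>u\<in>U. (\<Sum>j\<in>S. L j * u j)\<^sup>2) \<le> (\<Sum>j\<in>S. (L j)\<^sup>2)"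
proof -
  define c where "c u = (\<Sum>j\<in>S. L j * u j)" for u
  define P where "P j = (\<Sum>u\<in>U. c u * u j)" for j
  have LP: "(\<Sum>j\<in>S. L j * P j) = (\<Sum>u\<in>U. (c u)\<^sup>2)"
  proof -
    have "(\<Sum>j\<in>S. L j * P j) = (\<Sum>u\<in>U. \<Sum>j\<in>S. L j * (c u * u j))"
      unfolding P_def sum_distrib_left by (rule sum.swap)
    also have "\<dots> = (\<Sum>u\<in>U. (c u)\<^sup>2)"
    proof (rule sum.cong[OF refl])
      fix u
      have "(\<Sum>j\<in>S. L j * (c u * u j)) = c u * (\<Sum>j\<in>S. L j * u j)"
        by (simp add: sum_distrib_left algebra_simps)
      then show "(\<Sum>j\<in>S. L j * (c u * u j)) = (c u)\<^sup>2" by (simp add: c_def power2_eq_square)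
    qed
    finally show ?thesis .
  qed
  have uP: "(\<Sum>j\<in>S. u j * P j) = c u" if u: "u \<in> U" for u
  proof -
    have "(\<Sum>j\<in>S. u j * P j) = (\<Sum>v\<in>U. \<Sum>j\<in>S. u j * (c v * v j))"
      unfolding P_def sum_distrib_left by (rule sum.swap)
    also have "\<dots> = (\<Sum>v\<in>U. c v * (\<Sum>j\<in>S. u j * v j))"
      by (simp add: sum_distrib_left algebra_simps)
    also have "\<dots> = (\<Sum>v\<in>U. if v = u then c u else 0)"
      using assms(3,4) u by (intro sum.cong) auto
    finally show ?thesis using u assms by simp
  qed
  have PP: "(\<Sum>j\<in>S. P j * P j) = (\<Sum>u\<in>U. (c u)\<^sup>2)"
  proof -
    have "(\<Sum>j\<in>S. P j * P j) = (\<Sum>j\<in>S. \<Sum>u\<in>U. c u * (u j * P j))"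
      by (subst (1) P_def) (simp add: sum_distrib_right mult.assoc)
    also have "\<dots> = (\<Sum>u\<in>U. \<Sum>j\<in>S. c u * (u j * P j))" by (rule sum.swap)
    also have "\<dots> = (\<Sum>u\<in>U. c u * c u)"
      by (intro sum.cong) (auto simp: uP simp flip: sum_distrib_left)
    finally show ?thesis by (simp add: power2_eq_square)
  qed
  have "0 \<le> (\<Sum>j\<in>S. (L j - P j)\<^sup>2)" by (simp add: sum_nonneg)
  also have "\<dots> = (\<Sum>j\<in>S. (L j)\<^sup>2) - 2 * (\<Sum>j\<in>S. L j * P j) + (\<Sum>j\<in>S. P j * P j)"
    by (simp add: power2_eq_square algebra_simps sum.distrib sum_subtractf sum_distrib_left)
  finally show ?thesis by (simp add: LP PP c_def)
qed

text \<open>Averaging over an orthonormal system in the rescaled coordinates \<open>sqrt (d j) * v j\<close> and applying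
  Bessel's inequality to each form replaces an eigenvalue argument.\<close>
lemma quadratic_form_small_direction:
  fixes B :: "('c \<Rightarrow> real) set" and L :: "'e \<Rightarrow> 'c \<Rightarrow> real"
  assumes S: "finite S" "S \<noteq> {}" and B: "finite B" "2 * card B \<le> card S"
    and f: "\<And>e. e \<in> F \<Longrightarrow> f e \<ge> 0"
    and d: "\<And>j. j \<in> S \<Longrightarrow> d j > 0" "\<And>j. j \<in> S \<Longrightarrow> (\<Sum>e\<in>F. f e * (L e j)\<^sup>2) \<le> d j"
  shows "\<exists>v. (\<forall>j. j \<notin> S \<longrightarrow> v j = 0) \<and> (\<exists>j\<in>S. v j \<noteq> 0) \<and>
             (\<forall>b\<in>B. (\<Sum>j\<in>S. b j * v j) = 0) \<and>
             (\<Sum>e\<in>F. f e * (\<Sum>j\<in>S. L e j * v j)\<^sup>2) \<le> 2 * (\<Sum>j\<in>S. d j * (v j)\<^sup>2)"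
proof -
  define sc where "sc g = (\<lambda>j. g j / sqrt (d j))" for g :: "'c \<Rightarrow> real"
  define r where "r = card S - card B"
  have cB: "card (sc ` B) \<le> card B" using B by (simp add: card_image_le)
  have "r + card (sc ` B) \<le> card S" using cB B unfolding r_def by linarith
  then obtain U where U: "finite U" "card U = r" "\<forall>u\<in>U. \<forall>j. j \<notin> S \<longrightarrow> u j = 0"
      "\<forall>u\<in>U. (\<Sum>j\<in>S. u j * u j) = 1"
      "\<forall>u\<in>U. \<forall>v\<in>U. u \<noteq> v \<longrightarrow> (\<Sum>j\<in>S. u j * v j) = 0"
      "\<forall>u\<in>U. \<forall>b\<in>sc ` B. (\<Sum>j\<in>S. b j * u j) = 0"
    using orthonormal_system_exists[of S "sc ` B" r] S B by (auto simp del: Set.ball_simps)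
  have r: "r > 0" "card S \<le> 2 * r"
  proof -
    have "card S > 0" using S by (simp add: card_gt_0_iff)
    then show "r > 0" "card S \<le> 2 * r" using B unfolding r_def by auto
  qed
  define Q where "Q u = (\<Sum>e\<in>F. f e * (\<Sum>j\<in>S. sc (L e) j * u j)\<^sup>2)" for u
  have "(\<Sum>u\<in>U. Q u) = (\<Sum>e\<in>F. f e * (\<Sum>u\<in>U. (\<Sum>j\<in>S. sc (L e) j * u j)\<^sup>2))"
    unfolding Q_def by (subst sum.swap) (simp add: sum_distrib_left)
  also have "\<dots> \<le> (\<Sum>e\<in>F. f e * (\<Sum>j\<in>S. (sc (L e) j)\<^sup>2))"
    by (intro sum_mono mult_left_mono bessel_finite f) (use S U in auto)
  also have "\<dots> = (\<Sum>j\<in>S. \<Sum>e\<in>F. f e * (sc (L e) j)\<^sup>2)"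
    unfolding sum_distrib_left by (rule sum.swap)
  also have "\<dots> \<le> (\<Sum>j\<in>S. 1)"
  proof (rule sum_mono)
    fix j assume j: "j \<in> S"
    have "(\<Sum>e\<in>F. f e * (sc (L e) j)\<^sup>2) = (\<Sum>e\<in>F. f e * (L e j)\<^sup>2) / d j"
      using d(1)[OF j] by (simp add: sc_def power_divide sum_divide_distrib)
    also have "\<dots> \<le> 1" using d[OF j] by simp
    finally show "(\<Sum>e\<in>F. f e * (sc (L e) j)\<^sup>2) \<le> 1" .
  qed
  finally have le: "(\<Sum>u\<in>U. Q u) \<le> real (card S)" by simp
  have "\<exists>u\<in>U. Q u \<le> 2"
  proof (rule ccontr)
    assume "\<not> ?thesis"
    then have gt: "\<forall>u\<in>U. 2 < Q u" by auto
    have "U \<noteq> {}" using r U by auto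
    then have "(\<Sum>u\<in>U. 2) < (\<Sum>u\<in>U. Q u)" using U(1) gt by (intro sum_strict_mono) auto
    then have "2 * real r < real (card S)" using le U(2) by simp
    then show False using r by linarith
  qed
  then obtain u where u: "u \<in> U" "Q u \<le> 2" by blast
  define v where "v = sc u"
  have shift: "(\<Sum>j\<in>S. g j * v j) = (\<Sum>j\<in>S. sc g j * u j)" for g
    by (simp add: v_def sc_def)
  have one: "(\<Sum>j\<in>S. d j * (v j)\<^sup>2) = 1"
  proof -
    have "(\<Sum>j\<in>S. d j * (v j)\<^sup>2) = (\<Sum>j\<in>S. u j * u j)"
    proof (rule sum.cong[OF refl])
      fix j assume "j \<in> S"
      with d(1)[of j] show "d j * (v j)\<^sup>2 = u j * u j"
        by (simp add: v_def sc_def power_divide) (simp add: power2_eq_square)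
    qed
    then show ?thesis using U u by simp
  qed
  have "\<exists>j\<in>S. v j \<noteq> 0"
  proof (rule ccontr)
    assume "\<not> ?thesis"
    then have "(\<Sum>j\<in>S. d j * (v j)\<^sup>2) = 0" by (intro sum.neutral) auto
    then show False using one by simp
  qed
  moreover have "\<forall>j. j \<notin> S \<longrightarrow> v j = 0" using U(3) u by (auto simp: v_def sc_def)
  moreover have "\<forall>b\<in>B. (\<Sum>j\<in>S. b j * v j) = 0" using U(6) u by (auto simp: shift)
  moreover have "(\<Sum>e\<in>F. f e * (\<Sum>j\<in>S. L e j * v j)\<^sup>2) \<le> 2 * (\<Sum>j\<in>S. d j * (v j)\<^sup>2)"
    using u(2) by (simp add: one Q_def shift)
  ultimately show ?thesis by blast
qed

section \<open>The potential\<close>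

definition lform :: "'c set \<Rightarrow> ('c \<Rightarrow> real) \<Rightarrow> ('c \<Rightarrow> real) \<Rightarrow> real" where
  "lform N a x = (\<Sum>j\<in>N. a j * x j)"

definition slack :: "'c set \<Rightarrow> ('c \<Rightarrow> real) \<Rightarrow> ('c \<Rightarrow> real) \<Rightarrow> real" where
  "slack N a x = (\<Sum>j\<in>N. (a j)\<^sup>2 * (1 - (x j)\<^sup>2))"

definition alive :: "'c set \<Rightarrow> ('c \<Rightarrow> real) \<Rightarrow> 'c set" where
  "alive N x = {j \<in> N. \<bar>x j\<bar> < 1}"

definition potential ::
  "'c set \<Rightarrow> 'e set \<Rightarrow> ('e \<Rightarrow> 'c \<Rightarrow> real) \<Rightarrow> ('e \<Rightarrow> real) \<Rightarrow> real \<Rightarrow> ('c \<Rightarrow> real) \<Rightarrow> real" where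
  "potential N F a w \<eta> x =
     (\<Sum>e\<in>F. w e * exp (lform N (a e) x + 5 * slack N (a e) x)) + \<eta> * slack N (\<lambda>_. 1) x"

lemma exp_le_quadratic:
  fixes z :: real
  assumes "\<bar>z\<bar> \<le> 1"
  shows "exp z \<le> 1 + z + z\<^sup>2"
proof (cases "z \<ge> 0")
  case True
  then show ?thesis using assms by (intro exp_bound) auto
next
  case False
  define u where "u = - z"
  have u: "u > 0" "z = - u" using False by (auto simp: u_def)
  have "exp z = 1 / exp u" by (simp add: u exp_minus field_simps)
  also have "\<dots> \<le> 1 / (1 + u)" using u by (intro divide_left_mono) (auto intro: mult_pos_pos)
  also have "\<dots> \<le> 1 - u + u\<^sup>2"
  proof -
    have "(1 - u + u\<^sup>2) * (1 + u) = 1 + u ^ 3"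
      by (simp add: algebra_simps power2_eq_square power3_eq_cube)
    also have "\<dots> \<ge> 1" using u by simp
    finally show ?thesis using u by (simp add: pos_divide_le_eq)
  qed
  finally show ?thesis by (simp add: u)
qed

lemma lform_add_scaled: "lform N a (\<lambda>j. y j + \<tau> * v j) = lform N a y + \<tau> * lform N a v"
  by (simp add: lform_def algebra_simps sum.distrib sum_distrib_left)

lemma slack_add_scaled:
  "slack N a (\<lambda>j. y j + \<tau> * v j) =
     slack N a y - 2 * \<tau> * (\<Sum>j\<in>N. (a j)\<^sup>2 * y j * v j) - \<tau>\<^sup>2 * (\<Sum>j\<in>N. (a j)\<^sup>2 * (v j)\<^sup>2)"
  by (simp add: slack_def algebra_simps power2_eq_square sum.distrib sum_subtractf sum_distrib_left)

lemma slack_nonneg: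
  assumes "\<And>j. j \<in> N \<Longrightarrow> \<bar>x j\<bar> \<le> 1"
  shows "slack N a x \<ge> 0"
  unfolding slack_def using assms by (intro sum_nonneg mult_nonneg_nonneg) (auto simp: abs_square_le_1)

lemma potential_second_order:
  fixes a :: "'e \<Rightarrow> 'c \<Rightarrow> real"
  assumes fin: "finite N" "finite F"
    and w: "\<And>e. e \<in> F \<Longrightarrow> w e \<ge> 0"
    and a: "\<And>e j. e \<in> F \<Longrightarrow> j \<in> N \<Longrightarrow> \<bar>a e j\<bar> \<le> 1 / 20"
    and y: "\<And>j. j \<in> N \<Longrightarrow> \<bar>y j\<bar> \<le> 1"
    and \<eta>: "\<eta> > 0"
    and v: "\<exists>j\<in>N. v j \<noteq> 0"
    and f: "\<And>e. e \<in> F \<Longrightarrow> f e = w e * exp (lform N (a e) y + 5 * slack N (a e) y)"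
    and L: "\<And>e j. L e j = a e j - 10 * (a e j)\<^sup>2 * y j"
    and Q: "(\<Sum>e\<in>F. f e * (lform N (L e) v)\<^sup>2) \<le>
              2 * (\<Sum>j\<in>N. ((\<Sum>e\<in>F. f e * (L e j)\<^sup>2) + \<eta> / 4) * (v j)\<^sup>2)"
  shows "\<forall>\<^sub>F \<tau> in at_right 0.
           potential N F a w \<eta> (\<lambda>j. y j + \<tau> * v j) + potential N F a w \<eta> (\<lambda>j. y j + (-\<tau>) * v j)
             < 2 * potential N F a w \<eta> y"
proof -
  define l where "l e = lform N (L e) v" for e
  define q where "q e = 5 * (\<Sum>j\<in>N. (a e j)\<^sup>2 * (v j)\<^sup>2)" for e
  define V where "V = (\<Sum>j\<in>N. (v j)\<^sup>2)"
  have V: "V > 0" unfolding V_def using v fin by (auto intro!: sum_pos2)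
  have f0: "f e \<ge> 0" if "e \<in> F" for e using f[OF that] w[OF that] by simp
  have l: "l e = lform N (a e) v - 10 * (\<Sum>j\<in>N. (a e j)\<^sup>2 * y j * v j)" for e
    by (simp add: l_def lform_def L algebra_simps sum_subtractf sum_distrib_left)
  have expo: "w e * exp (lform N (a e) (\<lambda>j. y j + \<tau> * v j) + 5 * slack N (a e) (\<lambda>j. y j + \<tau> * v j))
      = f e * exp (\<tau> * l e - \<tau>\<^sup>2 * q e)" if "e \<in> F" for e \<tau>
    unfolding f[OF that] lform_add_scaled slack_add_scaled l q_def
    by (simp add: exp_add[symmetric] mult.assoc) (simp add: algebra_simps)
  have Lsq: "(L e j)\<^sup>2 \<le> 9 / 4 * (a e j)\<^sup>2" if "e \<in> F" "j \<in> N" for e j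
  proof -
    have "\<bar>10 * a e j * y j\<bar> \<le> 10 * (1 / 20) * 1"
      unfolding abs_mult using a[OF that] y[OF that(2)] by (intro mult_mono) auto
    then have "\<bar>1 - 10 * a e j * y j\<bar> \<le> 3 / 2" by linarith
    then have "(1 - 10 * a e j * y j)\<^sup>2 \<le> (3 / 2)\<^sup>2" by (intro power2_le_iff_abs_le[THEN iffD2]) auto
    then have "(a e j)\<^sup>2 * (1 - 10 * a e j * y j)\<^sup>2 \<le> (a e j)\<^sup>2 * (9 / 4)"
      by (intro mult_left_mono) (auto simp: power2_eq_square)
    moreover have "L e j = a e j * (1 - 10 * a e j * y j)"
      by (simp add: L algebra_simps power2_eq_square)
    ultimately show ?thesis by (simp add: power_mult_distrib)
  qed
  have "(\<Sum>e\<in>F. f e * (l e)\<^sup>2) \<le> 2 * (\<Sum>j\<in>N. ((\<Sum>e\<in>F. f e * (L e j)\<^sup>2) + \<eta> / 4) * (v j)\<^sup>2)"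
    using Q by (simp add: l_def)
  also have "\<dots> \<le> 2 * (\<Sum>j\<in>N. ((\<Sum>e\<in>F. f e * (9 / 4 * (a e j)\<^sup>2)) + \<eta> / 4) * (v j)\<^sup>2)"
    by (intro mult_left_mono sum_mono mult_right_mono add_right_mono Lsq f0) auto
  also have "\<dots> = 9 / 2 * (\<Sum>j\<in>N. \<Sum>e\<in>F. f e * ((a e j)\<^sup>2 * (v j)\<^sup>2)) + \<eta> / 2 * V"
    by (simp add: V_def algebra_simps sum.distrib sum_distrib_left sum_distrib_right)
  also have "(\<Sum>j\<in>N. \<Sum>e\<in>F. f e * ((a e j)\<^sup>2 * (v j)\<^sup>2)) = (\<Sum>e\<in>F. f e * q e) / 5"
    by (subst sum.swap) (simp add: q_def sum_distrib_left sum_divide_distrib)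
  finally have main: "(\<Sum>e\<in>F. f e * (l e)\<^sup>2) \<le> 9 / 10 * (\<Sum>e\<in>F. f e * q e) + \<eta> / 2 * V" by simp
  have q0: "q e \<ge> 0" for e unfolding q_def by (simp add: sum_nonneg)
  have fq: "(\<Sum>e\<in>F. f e * q e) \<ge> 0" using f0 q0 by (intro sum_nonneg mult_nonneg_nonneg) auto
  define M where "M = (\<Sum>e\<in>F. f e * (q e)\<^sup>2)"
  have small: "\<forall>\<^sub>F \<tau> in at_right 0. \<forall>e\<in>F. \<tau> * \<bar>l e\<bar> + \<tau>\<^sup>2 * q e \<le> 1"
  proof (rule eventually_ball_finite[OF fin(2)], rule ballI)
    fix e
    have "((\<lambda>\<tau>. \<tau> * \<bar>l e\<bar> + \<tau>\<^sup>2 * q e) \<longlongrightarrow> 0 * \<bar>l e\<bar> + 0\<^sup>2 * q e) (at_right 0)"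
      by (intro tendsto_intros)
    then have "\<forall>\<^sub>F \<tau> in at_right 0. \<tau> * \<bar>l e\<bar> + \<tau>\<^sup>2 * q e < 1"
      by (rule order_tendstoD) simp
    then show "\<forall>\<^sub>F \<tau> in at_right 0. \<tau> * \<bar>l e\<bar> + \<tau>\<^sup>2 * q e \<le> 1"
      by (rule eventually_mono) simp
  qed
  have small2: "\<forall>\<^sub>F \<tau> in at_right 0. \<tau>\<^sup>2 * M < \<eta> / 2 * V"
  proof -
    have "((\<lambda>\<tau>. \<tau>\<^sup>2 * M) \<longlongrightarrow> 0\<^sup>2 * M) (at_right 0)" by (intro tendsto_intros)
    then show ?thesis by (rule order_tendstoD) (use \<eta> V in simp)
  qed
  have pos: "\<forall>\<^sub>F \<tau> :: real in at_right 0. \<tau> > 0" by (simp add: eventually_at_right_less)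
  show ?thesis using small small2 pos
  proof eventually_elim
    case (elim \<tau>)
    have two: "exp (\<tau> * l e - \<tau>\<^sup>2 * q e) + exp (- \<tau> * l e - (- \<tau>)\<^sup>2 * q e)
        \<le> 2 + 2 * \<tau>\<^sup>2 * ((l e)\<^sup>2 - q e) + 2 * \<tau>^4 * (q e)\<^sup>2" if e: "e \<in> F" for e
    proof -
      have b: "\<tau> * \<bar>l e\<bar> + \<tau>\<^sup>2 * q e \<le> 1" using elim e by blast
      have "\<bar>\<tau> * l e\<bar> = \<tau> * \<bar>l e\<bar>" "\<tau>\<^sup>2 * q e \<ge> 0" using elim q0[of e] by (auto simp: abs_mult)
      then have "\<bar>\<tau> * l e - \<tau>\<^sup>2 * q e\<bar> \<le> 1" "\<bar>- \<tau> * l e - \<tau>\<^sup>2 * q e\<bar> \<le> 1" using b by linarith+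
      from exp_le_quadratic[OF this(1)] exp_le_quadratic[OF this(2)]
      show ?thesis by (simp add: power2_eq_square power4_eq_xxxx algebra_simps)
    qed
    have "potential N F a w \<eta> (\<lambda>j. y j + \<tau> * v j) + potential N F a w \<eta> (\<lambda>j. y j + (-\<tau>) * v j)
        = (\<Sum>e\<in>F. f e * (exp (\<tau> * l e - \<tau>\<^sup>2 * q e) + exp (- \<tau> * l e - (- \<tau>)\<^sup>2 * q e)))
          + 2 * \<eta> * (slack N (\<lambda>_. 1) y - \<tau>\<^sup>2 * V)"
    proof -
      have "slack N (\<lambda>_. 1) (\<lambda>j. y j + \<tau> * v j) + slack N (\<lambda>_. 1) (\<lambda>j. y j + (-\<tau>) * v j)
          = 2 * (slack N (\<lambda>_. 1) y - \<tau>\<^sup>2 * V)"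
        unfolding slack_add_scaled by (simp add: V_def)
      then have "\<eta> * slack N (\<lambda>_. 1) (\<lambda>j. y j + \<tau> * v j) + \<eta> * slack N (\<lambda>_. 1) (\<lambda>j. y j + (-\<tau>) * v j)
          = 2 * \<eta> * (slack N (\<lambda>_. 1) y - \<tau>\<^sup>2 * V)"
        unfolding distrib_left[symmetric] by simp
      then show ?thesis
        unfolding potential_def distrib_left sum.distrib by (simp only: expo cong: sum.cong)
    qed
    also have "\<dots> \<le> (\<Sum>e\<in>F. f e * (2 + 2 * \<tau>\<^sup>2 * ((l e)\<^sup>2 - q e) + 2 * \<tau>^4 * (q e)\<^sup>2))
          + 2 * \<eta> * (slack N (\<lambda>_. 1) y - \<tau>\<^sup>2 * V)"
      by (intro add_right_mono sum_mono mult_left_mono two f0)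
    also have "(\<Sum>e\<in>F. f e * (2 + 2 * \<tau>\<^sup>2 * ((l e)\<^sup>2 - q e) + 2 * \<tau>^4 * (q e)\<^sup>2)) =
        2 * (\<Sum>e\<in>F. f e) + 2 * \<tau>\<^sup>2 * ((\<Sum>e\<in>F. f e * (l e)\<^sup>2) - (\<Sum>e\<in>F. f e * q e)) + 2 * \<tau>^4 * M"
      by (simp add: M_def distrib_left right_diff_distrib sum.distrib sum_subtractf sum_distrib_left
          sum_distrib_right mult_ac)
    also have "(\<Sum>e\<in>F. f e * (l e)\<^sup>2) - (\<Sum>e\<in>F. f e * q e) \<le> \<eta> / 2 * V" using main fq by linarith
    finally have "potential N F a w \<eta> (\<lambda>j. y j + \<tau> * v j) + potential N F a w \<eta> (\<lambda>j. y j + (-\<tau>) * v j)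
        \<le> 2 * (\<Sum>e\<in>F. f e) + 2 * \<tau>\<^sup>2 * (\<eta> / 2 * V) + 2 * \<tau>^4 * M
          + 2 * \<eta> * (slack N (\<lambda>_. 1) y - \<tau>\<^sup>2 * V)"
      by (simp add: mult_left_mono)
    also have "\<dots> = 2 * ((\<Sum>e\<in>F. f e) + \<eta> * slack N (\<lambda>_. 1) y) + 2 * \<tau>\<^sup>2 * (\<tau>\<^sup>2 * M - \<eta> / 2 * V)"
      by (simp add: algebra_simps power2_eq_square power4_eq_xxxx)
    also have "\<dots> < 2 * ((\<Sum>e\<in>F. f e) + \<eta> * slack N (\<lambda>_. 1) y)"
      using elim by (simp add: mult_pos_neg)
    also have "(\<Sum>e\<in>F. f e) + \<eta> * slack N (\<lambda>_. 1) y = potential N F a w \<eta> y"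
      by (simp add: potential_def f)
    finally show ?case .
  qed
qed

lemma compact_coordinate_box:
  fixes x :: "'c \<Rightarrow> real"
  shows "compact {y. (\<forall>j\<in>S. \<bar>y j\<bar> \<le> 1) \<and> (\<forall>j. j \<notin> S \<longrightarrow> y j = x j)}"
proof -
  have "compactin (product_topology (\<lambda>_. euclidean) UNIV)
          (PiE UNIV (\<lambda>j. if j \<in> S then {-1..1} else {x j :: real}))"
    by (subst compactin_PiE) auto
  moreover have "PiE UNIV (\<lambda>j. if j \<in> S then {-1..1} else {x j :: real}) =
      {y. (\<forall>j\<in>S. \<bar>y j\<bar> \<le> 1) \<and> (\<forall>j. j \<notin> S \<longrightarrow> y j = x j)}"
    by (fastforce simp: PiE_def Pi_def abs_le_iff split: if_splits)
  ultimately show ?thesis by (simp add: euclidean_product_topology)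
qed

lemma continuous_on_lform [continuous_intros]: "continuous_on A (lform N a)"
  unfolding lform_def
  by (intro continuous_intros continuous_on_product_then_coordinatewise continuous_on_id)

lemma continuous_on_slack [continuous_intros]: "continuous_on A (slack N a)"
  unfolding slack_def
  by (intro continuous_intros continuous_on_product_then_coordinatewise continuous_on_id)

lemma continuous_on_potential [continuous_intros]: "continuous_on A (potential N F a w \<eta>)"
  unfolding potential_def by (intro continuous_intros)

text \<open>A minimiser of the potential over the feasible polytope cannot have all coordinates of \<open>S\<close> in the
  open interval: otherwise some \<open>v\<close> fixes \<open>B\<close> and the tight constraints and makes the potential
  strictly concave to second order, so one of \<open>y + \<tau> v\<close>, \<open>y - \<tau> v\<close> is better.\<close>

lemma freeze_coordinate:
  fixes a :: "'e \<Rightarrow> 'c \<Rightarrow> real"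
  assumes fin: "finite N" "finite F" "finite B"
    and x: "\<And>j. j \<in> N \<Longrightarrow> \<bar>x j\<bar> \<le> 1"
    and S: "S = alive N x" "S \<noteq> {}"
    and w: "\<And>e. e \<in> F \<Longrightarrow> w e \<ge> 0"
    and a: "\<And>e j. e \<in> F \<Longrightarrow> j \<in> N \<Longrightarrow> \<bar>a e j\<bar> \<le> 1 / 20"
    and \<eta>: "\<eta> > 0"
    and b: "\<And>e. e \<in> F \<Longrightarrow> lform N (a e) x \<le> b e"
    and count: "\<And>y. \<forall>j. j \<notin> S \<longrightarrow> y j = x j \<Longrightarrow> \<forall>j\<in>N. \<bar>y j\<bar> \<le> 1 \<Longrightarrow>
      \<forall>e\<in>F. lform N (a e) y \<le> b e \<Longrightarrow> potential N F a w \<eta> y \<le> potential N F a w \<eta> x \<Longrightarrow>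
      2 * (card B + card {e\<in>F. lform N (a e) y = b e}) \<le> card S"
  obtains y where "\<forall>j. j \<notin> S \<longrightarrow> y j = x j" "\<forall>j\<in>N. \<bar>y j\<bar> \<le> 1"
    "\<forall>e\<in>F. lform N (a e) y \<le> b e" "potential N F a w \<eta> y \<le> potential N F a w \<eta> x"
    "\<forall>g\<in>B. lform N g y = lform N g x" "\<exists>j\<in>S. \<bar>y j\<bar> = 1"
proof -
  let ?\<Phi> = "potential N F a w \<eta>"
  have SN: "S \<subseteq> N" "finite S" using fin S by (auto simp: alive_def)
  define Y where "Y = {y. (\<forall>j\<in>S. \<bar>y j\<bar> \<le> 1) \<and> (\<forall>j. j \<notin> S \<longrightarrow> y j = x j)} \<inter>
    ((\<Inter>e\<in>F. {y. lform N (a e) y \<le> b e}) \<inter> (\<Inter>g\<in>B. {y. lform N g y = lform N g x}))"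
  have "compact Y" unfolding Y_def
    by (intro compact_Int_closed compact_coordinate_box closed_Int closed_INT ballI
        closed_Collect_le closed_Collect_eq continuous_intros)
  moreover have xY: "x \<in> Y" using x b SN by (auto simp: Y_def)
  ultimately obtain y where y: "y \<in> Y" "\<And>z. z \<in> Y \<Longrightarrow> ?\<Phi> y \<le> ?\<Phi> z"
    using continuous_attains_inf[of Y ?\<Phi>] continuous_on_potential by blast
  have y1: "\<forall>j. j \<notin> S \<longrightarrow> y j = x j" "\<forall>j\<in>S. \<bar>y j\<bar> \<le> 1" "\<forall>e\<in>F. lform N (a e) y \<le> b e"
      "\<forall>g\<in>B. lform N g y = lform N g x" "?\<Phi> y \<le> ?\<Phi> x"
    using y xY by (auto simp: Y_def)
  have yN: "\<forall>j\<in>N. \<bar>y j\<bar> \<le> 1" using y1(1,2) x by metis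
  have "\<exists>j\<in>S. \<bar>y j\<bar> = 1"
  proof (rule ccontr)
    assume "\<not> ?thesis"
    then have open_y: "\<forall>j\<in>S. \<bar>y j\<bar> < 1" using y1(2) by (metis less_eq_real_def)
    define X where "X = {e\<in>F. lform N (a e) y = b e}"
    define f where "f e = w e * exp (lform N (a e) y + 5 * slack N (a e) y)" for e
    define L where "L e j = a e j - 10 * (a e j)\<^sup>2 * y j" for e j
    define d where "d j = (\<Sum>e\<in>F. f e * (L e j)\<^sup>2) + \<eta> / 4" for j
    have f0: "f e \<ge> 0" if "e \<in> F" for e using w[OF that] by (simp add: f_def)
    have dpos: "d j > 0" for j
      unfolding d_def using \<eta> f0 by (intro add_nonneg_pos sum_nonneg mult_nonneg_nonneg) auto
    have "2 * card (B \<union> a ` X) \<le> card S"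
    proof -
      have "card (B \<union> a ` X) \<le> card B + card X"
        using card_Un_le[of B "a ` X"] card_image_le[of X a] fin by (auto simp: X_def)
      then show ?thesis using count[OF y1(1) yN y1(3,5)] by (simp add: X_def)
    qed
    then have "\<exists>v. (\<forall>j. j \<notin> S \<longrightarrow> v j = 0) \<and> (\<exists>j\<in>S. v j \<noteq> 0) \<and>
             (\<forall>b\<in>B \<union> a ` X. (\<Sum>j\<in>S. b j * v j) = 0) \<and>
             (\<Sum>e\<in>F. f e * (\<Sum>j\<in>S. L e j * v j)\<^sup>2) \<le> 2 * (\<Sum>j\<in>S. d j * (v j)\<^sup>2)"
      using SN S(2) fin f0 dpos \<eta>
      by (intro quadratic_form_small_direction) (auto simp: X_def d_def)
    then obtain v where v: "\<forall>j. j \<notin> S \<longrightarrow> v j = 0" "\<exists>j\<in>S. v j \<noteq> 0"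
        "\<forall>b\<in>B \<union> a ` X. (\<Sum>j\<in>S. b j * v j) = 0"
        "(\<Sum>e\<in>F. f e * (\<Sum>j\<in>S. L e j * v j)\<^sup>2) \<le> 2 * (\<Sum>j\<in>S. d j * (v j)\<^sup>2)"
      by blast
    have toN: "(\<Sum>j\<in>S. g j * v j) = lform N g v" for g
      unfolding lform_def using SN fin v(1) by (intro sum.mono_neutral_left) auto
    have toN2: "(\<Sum>j\<in>S. d j * (v j)\<^sup>2) = (\<Sum>j\<in>N. d j * (v j)\<^sup>2)"
      using SN fin v(1) by (intro sum.mono_neutral_left) auto
    have Q: "(\<Sum>e\<in>F. f e * (lform N (L e) v)\<^sup>2) \<le> 2 * (\<Sum>j\<in>N. d j * (v j)\<^sup>2)"
      using v(4) unfolding toN toN2 .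
    have second: "\<forall>\<^sub>F \<tau> in at_right 0.
        ?\<Phi> (\<lambda>j. y j + \<tau> * v j) + ?\<Phi> (\<lambda>j. y j + (-\<tau>) * v j) < 2 * ?\<Phi> y"
      by (rule potential_second_order[OF fin(1,2) w a _ \<eta> _ _ _ Q[unfolded d_def]])
        (use yN v(2) SN in \<open>auto simp: f_def L_def\<close>)
    have ev1: "\<forall>\<^sub>F \<tau> in at_right 0. \<forall>j\<in>S. \<bar>y j\<bar> + \<tau> * \<bar>v j\<bar> < 1"
    proof (rule eventually_ball_finite[OF SN(2)], rule ballI)
      fix j assume j: "j \<in> S"
      have "((\<lambda>\<tau>. \<bar>y j\<bar> + \<tau> * \<bar>v j\<bar>) \<longlongrightarrow> \<bar>y j\<bar> + 0 * \<bar>v j\<bar>) (at_right 0)"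
        by (intro tendsto_intros)
      then show "\<forall>\<^sub>F \<tau> in at_right 0. \<bar>y j\<bar> + \<tau> * \<bar>v j\<bar> < 1"
        by (rule order_tendstoD) (use j open_y in auto)
    qed
    have ev2: "\<forall>\<^sub>F \<tau> in at_right 0. \<forall>e\<in>F - X. lform N (a e) y + \<tau> * \<bar>lform N (a e) v\<bar> < b e"
    proof (rule eventually_ball_finite)
      show "finite (F - X)" using fin by simp
      show "\<forall>e\<in>F - X. \<forall>\<^sub>F \<tau> in at_right 0. lform N (a e) y + \<tau> * \<bar>lform N (a e) v\<bar> < b e"
      proof
        fix e assume e: "e \<in> F - X"
        have "((\<lambda>\<tau>. lform N (a e) y + \<tau> * \<bar>lform N (a e) v\<bar>) \<longlongrightarrow>
            lform N (a e) y + 0 * \<bar>lform N (a e) v\<bar>) (at_right 0)"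
          by (intro tendsto_intros)
        then show "\<forall>\<^sub>F \<tau> in at_right 0. lform N (a e) y + \<tau> * \<bar>lform N (a e) v\<bar> < b e"
          by (rule order_tendstoD) (use e y1(3) in \<open>auto simp: X_def less_le\<close>)
      qed
    qed
    have pos: "\<forall>\<^sub>F \<tau> :: real in at_right 0. \<tau> > 0" by (simp add: eventually_at_right_less)
    obtain \<tau> where \<tau>: "?\<Phi> (\<lambda>j. y j + \<tau> * v j) + ?\<Phi> (\<lambda>j. y j + (-\<tau>) * v j) < 2 * ?\<Phi> y"
        "\<forall>j\<in>S. \<bar>y j\<bar> + \<tau> * \<bar>v j\<bar> < 1"
        "\<forall>e\<in>F - X. lform N (a e) y + \<tau> * \<bar>lform N (a e) v\<bar> < b e" "\<tau> > 0"
      using eventually_happens'[OF _ eventually_conj[OF second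
            eventually_conj[OF ev1 eventually_conj[OF ev2 pos]]]] by auto
    have inY: "(\<lambda>j. y j + \<sigma> * v j) \<in> Y" if \<sigma>: "\<bar>\<sigma>\<bar> = \<tau>" for \<sigma>
    proof -
      have "\<bar>y j + \<sigma> * v j\<bar> \<le> 1" if "j \<in> S" for j
      proof -
        have "\<bar>y j + \<sigma> * v j\<bar> \<le> \<bar>y j\<bar> + \<tau> * \<bar>v j\<bar>"
          using abs_triangle_ineq[of "y j" "\<sigma> * v j"] \<sigma> by (simp add: abs_mult)
        then show ?thesis using \<tau>(2) that by fastforce
      qed
      moreover have "lform N (a e) y + \<sigma> * lform N (a e) v \<le> b e" if e: "e \<in> F" for e
      proof (cases "e \<in> X")
        case True
        then have "lform N (a e) v = 0" using v(3) by (simp add: toN)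
        then show ?thesis using y1(3) e by simp
      next
        case False
        have "\<sigma> * lform N (a e) v \<le> \<bar>\<sigma> * lform N (a e) v\<bar>" by simp
        also have "\<dots> = \<tau> * \<bar>lform N (a e) v\<bar>" using \<sigma> by (simp add: abs_mult)
        finally have "\<sigma> * lform N (a e) v \<le> \<tau> * \<bar>lform N (a e) v\<bar>" .
        moreover have "lform N (a e) y + \<tau> * \<bar>lform N (a e) v\<bar> < b e" using \<tau>(3) e False by blast
        ultimately show ?thesis by linarith
      qed
      moreover have "lform N g y + \<sigma> * lform N g v = lform N g x" if "g \<in> B" for g
        using v(3) y1(4) that by (simp add: toN)
      ultimately show ?thesis
        using y1(1) v(1) by (auto simp: Y_def lform_add_scaled)
    qed
    have "?\<Phi> y \<le> ?\<Phi> (\<lambda>j. y j + \<tau> * v j)" "?\<Phi> y \<le> ?\<Phi> (\<lambda>j. y j + (-\<tau>) * v j)"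
      using inY[of \<tau>] inY[of "-\<tau>"] \<tau>(4) y(2) by auto
    then show False using \<tau>(1) by linarith
  qed
  then show thesis using that y1 yN by blast
qed

section \<open>The walk\<close>

text \<open>An item is a linear form that is kept equal to \<open>offs\<close> while it is heavy on the alive coordinates
  and is controlled one-sidedly (\<open>form - offs \<le> bnd\<close>) by an exponential potential of initial
  value at most \<open>wt\<close> afterwards. A blocker is a form that is kept fixed while it is heavy and is
  left alone afterwards.\<close>

datatype 'c item = Item (form: "'c \<Rightarrow> real") (offs: real) (thr: real) (wt: real) (bnd: real)

datatype 'c blocker = Blocker (bform: "'c \<Rightarrow> real") (boffs: real) (bthr: real)

definition heavy :: "'c set \<Rightarrow> 'c item \<Rightarrow> bool" where
  "heavy S e \<longleftrightarrow> (\<Sum>j\<in>S. (form e j)\<^sup>2) > thr e"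

definition bheavy :: "'c set \<Rightarrow> 'c blocker \<Rightarrow> bool" where
  "bheavy S g \<longleftrightarrow> (\<Sum>j\<in>S. \<bar>bform g j\<bar>) > bthr g"

definition admissible :: "'c set \<Rightarrow> 'c item \<Rightarrow> bool" where
  "admissible N e \<longleftrightarrow> wt e \<ge> 0 \<and> bnd e \<ge> 0 \<and> (\<forall>j\<in>N. \<bar>form e j\<bar> \<le> 1 / 20)"

definition item_pot :: "'c set \<Rightarrow> ('c \<Rightarrow> real) \<Rightarrow> 'c item \<Rightarrow> real" where
  "item_pot N x e = (if heavy (alive N x) e then wt e
     else wt e * exp (lform N (form e) x - offs e + 5 * (slack N (form e) x - thr e)))"

definition total_pot :: "'c set \<Rightarrow> 'c item set \<Rightarrow> real \<Rightarrow> ('c \<Rightarrow> real) \<Rightarrow> real" where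
  "total_pot N E \<eta> x = (\<Sum>e\<in>E. item_pot N x e) + \<eta> * slack N (\<lambda>_. 1) x"

definition refines :: "'c set \<Rightarrow> ('c \<Rightarrow> real) \<Rightarrow> ('c \<Rightarrow> real) \<Rightarrow> bool" where
  "refines N x y \<longleftrightarrow> (\<forall>j. j \<notin> alive N x \<longrightarrow> y j = x j) \<and> (\<forall>j\<in>N. \<bar>y j\<bar> \<le> 1)"

definition item_ok :: "'c set \<Rightarrow> ('c \<Rightarrow> real) \<Rightarrow> 'c item \<Rightarrow> bool" where
  "item_ok N x e \<longleftrightarrow> (if heavy (alive N x) e then lform N (form e) x = offs e
     else lform N (form e) x - offs e \<le> bnd e)"

definition blocker_ok :: "'c set \<Rightarrow> ('c \<Rightarrow> real) \<Rightarrow> 'c blocker \<Rightarrow> bool" where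
  "blocker_ok N x g \<longleftrightarrow> (if bheavy (alive N x) g then lform N (bform g) x = boffs g
     else \<forall>y. refines N x y \<longrightarrow> \<bar>lform N (bform g) y - boffs g\<bar> \<le> 2 * bthr g)"

definition walk_state ::
  "'c set \<Rightarrow> 'c item set \<Rightarrow> 'c blocker set \<Rightarrow> real \<Rightarrow> real \<Rightarrow> ('c \<Rightarrow> real) \<Rightarrow> bool" where
  "walk_state N E G \<eta> T x \<longleftrightarrow> (\<forall>j\<in>N. \<bar>x j\<bar> \<le> 1) \<and> total_pot N E \<eta> x \<le> T \<and>
     (\<forall>e\<in>E. item_ok N x e) \<and> (\<forall>g\<in>G. blocker_ok N x g)"

lemma alive_refines: "refines N x y \<Longrightarrow> alive N y \<subseteq> alive N x"
  unfolding refines_def alive_def by fastforce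

lemma refines_trans: "refines N x y \<Longrightarrow> refines N y z \<Longrightarrow> refines N x z"
  using alive_refines[of N x y] unfolding refines_def by (metis subsetD)

lemma slack_eq_alive:
  assumes "finite N" "\<forall>j\<in>N. \<bar>x j\<bar> \<le> 1"
  shows "slack N a x = (\<Sum>j\<in>alive N x. (a j)\<^sup>2 * (1 - (x j)\<^sup>2))"
  unfolding slack_def
proof (rule sum.mono_neutral_right)
  have "(x j)\<^sup>2 = 1" if "j \<in> N" "j \<notin> alive N x" for j
  proof -
    have "\<bar>x j\<bar> = 1" using assms(2) that by (force simp: alive_def)
    then show ?thesis by (metis power2_abs one_power2)
  qed
  then show "\<forall>i\<in>N - alive N x. (a i)\<^sup>2 * (1 - (x i)\<^sup>2) = 0" by auto
qed (use assms in \<open>auto simp: alive_def\<close>)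

lemma slack_le_alive:
  assumes "finite N" "\<forall>j\<in>N. \<bar>x j\<bar> \<le> 1"
  shows "slack N a x \<le> (\<Sum>j\<in>alive N x. (a j)\<^sup>2)"
  unfolding slack_eq_alive[OF assms]
  by (intro sum_mono mult_left_le) auto

lemma item_pot_at_offset:
  assumes "finite N" "\<forall>j\<in>N. \<bar>x j\<bar> \<le> 1" "wt e \<ge> 0" "lform N (form e) x = offs e"
  shows "item_pot N x e \<le> wt e"
proof -
  have "slack N (form e) x - thr e \<le> 0" if "\<not> heavy (alive N x) e"
    using that slack_le_alive[OF assms(1,2), where a = "form e"] by (simp add: heavy_def)
  then show ?thesis using assms by (auto simp: item_pot_def mult_left_le)
qed

lemma lform_refines_close:
  assumes "finite N" "\<forall>j\<in>N. \<bar>x j\<bar> \<le> 1" "refines N x y"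
  shows "\<bar>lform N g y - lform N g x\<bar> \<le> 2 * (\<Sum>j\<in>alive N x. \<bar>g j\<bar>)"
proof -
  have "lform N g y - lform N g x = (\<Sum>j\<in>N. g j * (y j - x j))"
    by (simp add: lform_def algebra_simps sum_subtractf)
  also have "\<dots> = (\<Sum>j\<in>alive N x. g j * (y j - x j))"
    using assms by (intro sum.mono_neutral_right) (auto simp: alive_def refines_def)
  also have "\<bar>\<dots>\<bar> \<le> (\<Sum>j\<in>alive N x. \<bar>g j * (y j - x j)\<bar>)" by (rule sum_abs)
  also have "\<dots> \<le> (\<Sum>j\<in>alive N x. \<bar>g j\<bar> * 2)"
  proof (rule sum_mono)
    fix j assume "j \<in> alive N x"
    then have "j \<in> N" by (simp add: alive_def)
    then have "\<bar>x j\<bar> \<le> 1" "\<bar>y j\<bar> \<le> 1" using assms by (auto simp: refines_def)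
    then have "\<bar>y j - x j\<bar> \<le> 2" by linarith
    then show "\<bar>g j * (y j - x j)\<bar> \<le> \<bar>g j\<bar> * 2" by (simp add: abs_mult mult_left_mono)
  qed
  finally show ?thesis by (simp add: sum_distrib_left mult.commute)
qed

lemma walk_state_add_items:
  assumes "finite N" "finite E" "finite E'" and st: "walk_state N E G \<eta> T x"
    and E': "\<And>e. e \<in> E' \<Longrightarrow> wt e \<ge> 0 \<and> bnd e \<ge> 0 \<and> lform N (form e) x = offs e"
  shows "walk_state N (E \<union> E') G \<eta> (T + (\<Sum>e\<in>E'. wt e)) x"
proof -
  have x: "\<forall>j\<in>N. \<bar>x j\<bar> \<le> 1" using st by (auto simp: walk_state_def)
  have "(\<Sum>e\<in>E \<union> E'. item_pot N x e) = (\<Sum>e\<in>E. item_pot N x e) + (\<Sum>e\<in>E' - E. item_pot N x e)"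
    using assms(2,3) by (subst sum.union_disjoint[symmetric]) (auto intro: sum.cong)
  also have "(\<Sum>e\<in>E' - E. item_pot N x e) \<le> (\<Sum>e\<in>E' - E. wt e)"
    using E' x assms(1) by (intro sum_mono item_pot_at_offset) auto
  also have "\<dots> \<le> (\<Sum>e\<in>E'. wt e)" using E' assms(3) by (intro sum_mono2) auto
  finally have "total_pot N (E \<union> E') \<eta> x \<le> T + (\<Sum>e\<in>E'. wt e)"
    using st by (simp add: total_pot_def walk_state_def)
  then show ?thesis using st E' by (auto simp: walk_state_def item_ok_def)
qed

lemma walk_state_add_blockers:
  assumes "finite N" and st: "walk_state N E G \<eta> T x"
    and G': "\<And>g. g \<in> G' \<Longrightarrow> lform N (bform g) x = boffs g"
  shows "walk_state N E (G \<union> G') \<eta> T x"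
proof -
  have x: "\<forall>j\<in>N. \<bar>x j\<bar> \<le> 1" using st by (auto simp: walk_state_def)
  have "blocker_ok N x g" if "g \<in> G'" for g
    using lform_refines_close[OF assms(1) x, of _ "bform g"] G'[OF that]
    by (fastforce simp: blocker_ok_def bheavy_def)
  then show ?thesis using st by (auto simp: walk_state_def)
qed

lemma walk_state_subset:
  assumes "finite E" "E' \<subseteq> E" "G' \<subseteq> G" "\<And>e. e \<in> E \<Longrightarrow> wt e \<ge> 0" "walk_state N E G \<eta> T x"
  shows "walk_state N E' G' \<eta> T x"
proof -
  have "(\<Sum>e\<in>E'. item_pot N x e) \<le> (\<Sum>e\<in>E. item_pot N x e)"
    using assms by (intro sum_mono2) (auto simp: item_pot_def)
  then show ?thesis using assms by (fastforce simp: walk_state_def total_pot_def)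
qed

lemma walk_step:
  assumes fin: "finite N" "finite E" "finite G" and \<eta>: "\<eta> > 0"
    and adm: "\<And>e. e \<in> E \<Longrightarrow> admissible N e"
    and st: "walk_state N E G \<eta> T x"
    and S: "S = alive N x" "S \<noteq> {}"
    and H: "4 * (card {e\<in>E. heavy S e} + card {g\<in>G. bheavy S g}) \<le> card S"
    and tight: "\<And>X. X \<subseteq> E \<Longrightarrow> (\<Sum>e\<in>X. wt e * exp (bnd e - 5 * thr e)) \<le> T \<Longrightarrow> 4 * card X \<le> card S"
  shows "\<exists>y. walk_state N E G \<eta> T y \<and> refines N x y \<and> alive N y \<subset> alive N x"
proof -
  define H where "H = {e\<in>E. heavy S e}"
  define F where "F = E - H"
  define BG where "BG = {g\<in>G. bheavy S g}"
  define B where "B = form ` H \<union> bform ` BG"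
  define w where "w e = wt e * exp (- offs e - 5 * thr e)" for e :: "'a item"
  define b where "b e = offs e + bnd e" for e :: "'a item"
  have x: "\<forall>j\<in>N. \<bar>x j\<bar> \<le> 1" using st by (auto simp: walk_state_def)
  have finS: "finite H" "finite F" "finite BG" "finite B"
    using fin by (auto simp: H_def F_def BG_def B_def)
  have cB: "card B \<le> card H + card BG"
    unfolding B_def using finS
    by (intro order.trans[OF card_Un_le] add_mono card_image_le) auto
  have E: "E = H \<union> F" "H \<inter> F = {}" by (auto simp: F_def H_def)
  have wt0: "wt e \<ge> 0" if "e \<in> E" for e using adm[OF that] by (simp add: admissible_def)
  have w0: "w e \<ge> 0" if "e \<in> F" for e using wt0[of e] that by (simp add: w_def F_def)
  have lite: "wt e * exp (lform N (form e) y - offs e + 5 * (slack N (form e) y - thr e)) =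
      w e * exp (lform N (form e) y + 5 * slack N (form e) y)" for e y
    by (simp add: w_def algebra_simps flip: exp_add)
  have pot: "total_pot N E \<eta> x = (\<Sum>e\<in>H. wt e) + potential N F form w \<eta> x"
  proof -
    have "(\<Sum>e\<in>E. item_pot N x e) = (\<Sum>e\<in>H. item_pot N x e) + (\<Sum>e\<in>F. item_pot N x e)"
      unfolding E(1) using finS E by (intro sum.union_disjoint) auto
    also have "(\<Sum>e\<in>H. item_pot N x e) = (\<Sum>e\<in>H. wt e)"
      by (intro sum.cong) (auto simp: item_pot_def H_def S)
    also have "(\<Sum>e\<in>F. item_pot N x e) = (\<Sum>e\<in>F. w e * exp (lform N (form e) x + 5 * slack N (form e) x))"
      by (intro sum.cong refl) (auto simp: item_pot_def F_def H_def S lite simp del: right_diff_distrib_numeral)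
    finally show ?thesis by (simp add: total_pot_def potential_def)
  qed
  have potT: "(\<Sum>e\<in>H. wt e) + potential N F form w \<eta> x \<le> T"
    using st pot by (simp add: walk_state_def)
  have bx: "lform N (form e) x \<le> b e" if "e \<in> F" for e
    using st that by (auto simp: walk_state_def F_def H_def item_ok_def b_def S)
  have count: "2 * (card B + card {e\<in>F. lform N (form e) y = b e}) \<le> card S"
    if y: "\<forall>j\<in>N. \<bar>y j\<bar> \<le> 1" "potential N F form w \<eta> y \<le> potential N F form w \<eta> x" for y
  proof -
    define X where "X = {e\<in>F. lform N (form e) y = b e}"
    have XF: "X \<subseteq> F" by (auto simp: X_def)
    have sl: "slack N a y \<ge> 0" for a using y(1) by (intro slack_nonneg) auto
    have "(\<Sum>e\<in>X. wt e * exp (bnd e - 5 * thr e)) \<le>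
        (\<Sum>e\<in>X. w e * exp (lform N (form e) y + 5 * slack N (form e) y))"
    proof (rule sum_mono)
      fix e assume e: "e \<in> X"
      have "wt e * exp (bnd e - 5 * thr e) \<le>
          wt e * exp (lform N (form e) y - offs e + 5 * (slack N (form e) y - thr e))"
        using e wt0[of e] sl[of "form e"] by (intro mult_left_mono) (auto simp: X_def b_def F_def)
      then show "wt e * exp (bnd e - 5 * thr e) \<le>
          w e * exp (lform N (form e) y + 5 * slack N (form e) y)"
        by (simp only: lite)
    qed
    also have "\<dots> \<le> (\<Sum>e\<in>F. w e * exp (lform N (form e) y + 5 * slack N (form e) y))"
      using XF finS w0 by (intro sum_mono2) auto
    also have "\<dots> \<le> potential N F form w \<eta> y"
      using \<eta> sl by (simp add: potential_def)
    also have "\<dots> \<le> T"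
    proof -
      have "(\<Sum>e\<in>H. wt e) \<ge> 0" using wt0 by (intro sum_nonneg) (auto simp: H_def)
      then show ?thesis using potT y(2) by linarith
    qed
    finally have "4 * card X \<le> card S" using XF E by (intro tight) auto
    then show ?thesis using H cB unfolding X_def[symmetric] H_def[symmetric] BG_def[symmetric]
      by (auto simp: algebra_simps)
  qed
  have form20: "\<bar>form e j\<bar> \<le> 1 / 20" if "e \<in> F" "j \<in> N" for e j
    using adm[of e] that by (auto simp: F_def admissible_def)
  obtain y where y: "\<forall>j. j \<notin> S \<longrightarrow> y j = x j" "\<forall>j\<in>N. \<bar>y j\<bar> \<le> 1"
    "\<forall>e\<in>F. lform N (form e) y \<le> b e" "potential N F form w \<eta> y \<le> potential N F form w \<eta> x"
    "\<forall>g\<in>B. lform N g y = lform N g x" "\<exists>j\<in>S. \<bar>y j\<bar> = 1"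
    by (rule freeze_coordinate[OF fin(1) finS(2,4) bspec[OF x] S w0 form20 \<eta> bx count])
  have comp: "refines N x y" using y(1,2) S by (simp add: refines_def)
  have sub: "alive N y \<subseteq> S" using alive_refines[OF comp] S by simp
  have psub: "alive N y \<subset> S" using sub y(6) by (auto simp: alive_def)
  have finSs: "finite S" using fin S by (simp add: alive_def)
  have hm: "heavy S e" if "heavy (alive N y) e" for e
  proof -
    have "(\<Sum>j\<in>alive N y. (form e j)\<^sup>2) \<le> (\<Sum>j\<in>S. (form e j)\<^sup>2)"
      using sub finSs by (intro sum_mono2) auto
    then show ?thesis using that by (simp add: heavy_def)
  qed
  have bhm: "bheavy S g" if "bheavy (alive N y) g" for g
  proof -
    have "(\<Sum>j\<in>alive N y. \<bar>bform g j\<bar>) \<le> (\<Sum>j\<in>S. \<bar>bform g j\<bar>)"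
      using sub finSs by (intro sum_mono2) auto
    then show ?thesis using that by (simp add: bheavy_def)
  qed
  have Hy: "lform N (form e) y = offs e" if "e \<in> H" for e
  proof -
    have "lform N (form e) y = lform N (form e) x" using y(5) that by (auto simp: B_def)
    also have "\<dots> = offs e" using st that by (auto simp: walk_state_def H_def item_ok_def S)
    finally show ?thesis .
  qed
  have BGy: "lform N (bform g) y = boffs g" if "g \<in> BG" for g
  proof -
    have "lform N (bform g) y = lform N (bform g) x" using y(5) that by (auto simp: B_def)
    also have "\<dots> = boffs g" using st that by (auto simp: walk_state_def BG_def blocker_ok_def S)
    finally show ?thesis .
  qed
  have "total_pot N E \<eta> y \<le> (\<Sum>e\<in>H. wt e) + potential N F form w \<eta> y"
  proof -
    have "(\<Sum>e\<in>E. item_pot N y e) = (\<Sum>e\<in>H. item_pot N y e) + (\<Sum>e\<in>F. item_pot N y e)"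
      unfolding E(1) using finS E by (intro sum.union_disjoint) auto
    also have "(\<Sum>e\<in>H. item_pot N y e) \<le> (\<Sum>e\<in>H. wt e)"
      using fin y(2) wt0 Hy by (intro sum_mono item_pot_at_offset) (auto simp: H_def)
    also have "(\<Sum>e\<in>F. item_pot N y e) = (\<Sum>e\<in>F. w e * exp (lform N (form e) y + 5 * slack N (form e) y))"
      using hm by (intro sum.cong refl) (auto simp: item_pot_def F_def H_def lite simp del: right_diff_distrib_numeral)
    finally show ?thesis by (simp add: total_pot_def potential_def)
  qed
  then have "total_pot N E \<eta> y \<le> T" using y(4) potT by linarith
  moreover have "item_ok N y e" if e: "e \<in> E" for e
  proof (cases "e \<in> H")
    case True
    then show ?thesis using Hy[OF True] adm[OF e] by (simp add: item_ok_def admissible_def)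
  next
    case False
    then have "e \<in> F" "\<not> heavy (alive N y) e" using e hm[of e] by (auto simp: F_def H_def)
    then show ?thesis using y(3) by (fastforce simp: item_ok_def b_def)
  qed
  moreover have "blocker_ok N y g" if g: "g \<in> G" for g
  proof (cases "g \<in> BG")
    case True
    show ?thesis
      using lform_refines_close[OF fin(1) y(2), of _ "bform g"] BGy[OF True]
      by (fastforce simp: blocker_ok_def bheavy_def)
  next
    case False
    then have "\<not> bheavy S g" using g by (simp add: BG_def)
    then show ?thesis using st g bhm[of g] refines_trans[OF comp]
      by (auto simp: walk_state_def blocker_ok_def S)
  qed
  ultimately have "walk_state N E G \<eta> T y" using y(2) by (simp add: walk_state_def)
  then show ?thesis using comp psub S by blast
qed

lemma walk_phase:
  assumes fin: "finite N" "finite E" "finite G" and \<eta>: "\<eta> > 0"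
    and adm: "\<And>e. e \<in> E \<Longrightarrow> admissible N e"
    and st: "walk_state N E G \<eta> T x"
    and s: "s \<ge> 0"
    and H: "\<And>S. S \<subseteq> alive N x \<Longrightarrow> real (card S) > s \<Longrightarrow>
      4 * (card {e\<in>E. heavy S e} + card {g\<in>G. bheavy S g}) \<le> card S"
    and tight: "\<And>X. X \<subseteq> E \<Longrightarrow> (\<Sum>e\<in>X. wt e * exp (bnd e - 5 * thr e)) \<le> T \<Longrightarrow> 4 * real (card X) \<le> s"
  shows "\<exists>y. walk_state N E G \<eta> T y \<and> refines N x y \<and> real (card (alive N y)) \<le> s"
  using st H
proof (induction "card (alive N x)" arbitrary: x rule: less_induct)
  case less
  have self: "refines N x x" using less.prems by (simp add: refines_def walk_state_def)
  show ?case
  proof (cases "real (card (alive N x)) \<le> s")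
    case True
    then show ?thesis using less.prems self by blast
  next
    case False
    have "4 * card X \<le> card (alive N x)"
      if "X \<subseteq> E" "(\<Sum>e\<in>X. wt e * exp (bnd e - 5 * thr e)) \<le> T" for X
      using tight[OF that] False by linarith
    moreover have "alive N x \<noteq> {}" using False s by auto
    moreover have "4 * (card {e\<in>E. heavy (alive N x) e} + card {g\<in>G. bheavy (alive N x) g})
        \<le> card (alive N x)"
      using less.prems(2)[OF subset_refl] False by simp
    ultimately have "\<exists>y. walk_state N E G \<eta> T y \<and> refines N x y \<and> alive N y \<subset> alive N x"
      by (intro walk_step[OF fin \<eta> adm less.prems(1) refl])
    then obtain y where y: "walk_state N E G \<eta> T y" "refines N x y" "alive N y \<subset> alive N x"
      by blast
    have "finite (alive N x)" using fin by (simp add: alive_def)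
    then have "card (alive N y) < card (alive N x)" using y by (intro psubset_card_mono)
    then obtain z where "walk_state N E G \<eta> T z" "refines N y z" "real (card (alive N z)) \<le> s"
      using less.hyps[OF _ y(1)] less.prems(2) y(3) by (meson order.trans psubset_imp_subset)
    then show ?thesis using refines_trans[OF y(2)] by blast
  qed
qed

section \<open>Spread matrices\<close>

definition row_items ::
  "'r set \<Rightarrow> ('r \<Rightarrow> 'c \<Rightarrow> real) \<Rightarrow> real \<Rightarrow> ('r \<Rightarrow> real) \<Rightarrow> real \<Rightarrow> real \<Rightarrow> real \<Rightarrow> 'c item set" where
  "row_items R \<rho> l p h \<beta> b =
     (\<lambda>(s, i). Item (\<lambda>c. s * l * \<rho> i c) (s * l * p i) h \<beta> b) ` ({1, -1} \<times> R)"

definition row_blockers ::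
  "'r set \<Rightarrow> ('r \<Rightarrow> 'c \<Rightarrow> real) \<Rightarrow> ('r \<Rightarrow> real) \<Rightarrow> real \<Rightarrow> 'c blocker set" where
  "row_blockers R \<rho> p u = (\<lambda>i. Blocker (\<rho> i) (p i) u) ` R"

lemma finite_row_items [simp]: "finite R \<Longrightarrow> finite (row_items R \<rho> l p h \<beta> b)"
  by (simp add: row_items_def)

lemma finite_row_blockers [simp]: "finite R \<Longrightarrow> finite (row_blockers R \<rho> p u)"
  by (simp add: row_blockers_def)

lemma row_items_cases:
  assumes "e \<in> row_items R \<rho> l p h \<beta> b"
  obtains s i where "s = 1 \<or> s = -1" "i \<in> R" "e = Item (\<lambda>c. s * l * \<rho> i c) (s * l * p i) h \<beta> b"
  using assms by (auto simp: row_items_def)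

lemma card_row_items_le:
  assumes "finite R"
  shows "card (row_items R \<rho> l p h \<beta> b) \<le> 2 * card R"
proof -
  have "card (row_items R \<rho> l p h \<beta> b) \<le> card ({1, -1 :: real} \<times> R)"
    unfolding row_items_def using assms by (intro card_image_le) auto
  then show ?thesis by (simp add: card_cartesian_product)
qed

lemma sum_wt_row_items_le:
  fixes \<beta> :: real
  assumes "finite R" "\<beta> \<ge> 0"
  shows "(\<Sum>e\<in>row_items R \<rho> l p h \<beta> b. wt e) \<le> 2 * card R * \<beta>"
proof -
  have "(\<Sum>e\<in>row_items R \<rho> l p h \<beta> b. wt e) = (\<Sum>e\<in>row_items R \<rho> l p h \<beta> b. \<beta>)"
    by (intro sum.cong) (auto simp: row_items_def)
  also have "\<dots> = card (row_items R \<rho> l p h \<beta> b) * \<beta>" by simp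
  also have "\<dots> \<le> real (2 * card R) * \<beta>"
    using card_row_items_le[OF assms(1), of \<rho> l p h \<beta> b] assms(2)
    by (intro mult_right_mono) (simp_all only: of_nat_le_iff)
  finally show ?thesis by simp
qed

lemma card_heavy_row_items_le:
  assumes "finite R" "l > 0" "h = l\<^sup>2 * u" and "\<And>i c. i \<in> R \<Longrightarrow> c \<in> S \<Longrightarrow> \<bar>\<rho> i c\<bar> \<le> 1"
  shows "card {e\<in>row_items R \<rho> l p h \<beta> b. heavy S e} \<le> 2 * card {i\<in>R. (\<Sum>c\<in>S. \<bar>\<rho> i c\<bar>) > u}"
proof -
  have "{e\<in>row_items R \<rho> l p h \<beta> b. heavy S e} \<subseteq> row_items {i\<in>R. (\<Sum>c\<in>S. \<bar>\<rho> i c\<bar>) > u} \<rho> l p h \<beta> b"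
  proof
    fix e assume "e \<in> {e\<in>row_items R \<rho> l p h \<beta> b. heavy S e}"
    then have e: "e \<in> row_items R \<rho> l p h \<beta> b" "heavy S e" by auto
    from e(1) obtain s i where si: "s = 1 \<or> s = -1" "i \<in> R"
        "e = Item (\<lambda>c. s * l * \<rho> i c) (s * l * p i) h \<beta> b"
      by (rule row_items_cases)
    have "l\<^sup>2 * u < (\<Sum>c\<in>S. (s * l * \<rho> i c)\<^sup>2)" using e(2) si assms(3) by (simp add: heavy_def)
    also have "\<dots> = l\<^sup>2 * (\<Sum>c\<in>S. (\<rho> i c)\<^sup>2)"
      using si(1) by (auto simp: power_mult_distrib sum_distrib_left)
    also have "\<dots> \<le> l\<^sup>2 * (\<Sum>c\<in>S. \<bar>\<rho> i c\<bar>)"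
    proof (intro mult_left_mono sum_mono)
      fix c assume "c \<in> S"
      then have "\<bar>\<rho> i c\<bar> * \<bar>\<rho> i c\<bar> \<le> \<bar>\<rho> i c\<bar> * 1"
        using assms(4)[OF si(2)] by (intro mult_left_mono) auto
      then show "(\<rho> i c)\<^sup>2 \<le> \<bar>\<rho> i c\<bar>" by (simp add: power2_eq_square)
    qed simp
    finally have "u < (\<Sum>c\<in>S. \<bar>\<rho> i c\<bar>)" using assms(2) by simp
    then show "e \<in> row_items {i\<in>R. (\<Sum>c\<in>S. \<bar>\<rho> i c\<bar>) > u} \<rho> l p h \<beta> b"
      using si by (auto simp: row_items_def image_iff)
  qed
  then have "card {e\<in>row_items R \<rho> l p h \<beta> b. heavy S e}
      \<le> card (row_items {i\<in>R. (\<Sum>c\<in>S. \<bar>\<rho> i c\<bar>) > u} \<rho> l p h \<beta> b)"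
    using assms(1) by (intro card_mono) auto
  also have "\<dots> \<le> 2 * card {i\<in>R. (\<Sum>c\<in>S. \<bar>\<rho> i c\<bar>) > u}"
    using assms(1) by (intro card_row_items_le) auto
  finally show ?thesis .
qed

lemma card_bheavy_row_blockers_le:
  assumes "finite R"
  shows "card {g\<in>row_blockers R \<rho> p u. bheavy S g} \<le> card {i\<in>R. (\<Sum>c\<in>S. \<bar>\<rho> i c\<bar>) > u}"
proof -
  have "{g\<in>row_blockers R \<rho> p u. bheavy S g} = row_blockers {i\<in>R. (\<Sum>c\<in>S. \<bar>\<rho> i c\<bar>) > u} \<rho> p u"
    by (auto simp: row_blockers_def bheavy_def)
  then show ?thesis using assms by (simp add: row_blockers_def card_image_le)
qed

lemma admissible_row_items:
  assumes "\<beta> \<ge> 0" "b \<ge> 0" "0 < l" "l \<le> 1 / 20" "\<And>i c. i \<in> R \<Longrightarrow> c \<in> N \<Longrightarrow> \<bar>\<rho> i c\<bar> \<le> 1"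
    and "e \<in> row_items R \<rho> l p h \<beta> b"
  shows "admissible N e"
proof -
  from assms(6) obtain s i where si: "s = 1 \<or> s = -1" "i \<in> R"
      "e = Item (\<lambda>c. s * l * \<rho> i c) (s * l * p i) h \<beta> b"
    by (rule row_items_cases)
  have "\<bar>s * l * \<rho> i c\<bar> \<le> 1 / 20" if "c \<in> N" for c
  proof -
    have "\<bar>s * l * \<rho> i c\<bar> = l * \<bar>\<rho> i c\<bar>" using si(1) assms(3) by (auto simp: abs_mult)
    also have "\<dots> \<le> 1 / 20 * 1" using assms(3-5) si that by (intro mult_mono) auto
    finally show ?thesis by simp
  qed
  then show ?thesis using assms si by (simp add: admissible_def)
qed

lemma lform_scale: "lform N (\<lambda>c. s * g c) y = s * lform N g y"
  by (simp add: lform_def sum_distrib_left algebra_simps)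

lemma row_items_bound:
  assumes "l > 0" "b \<ge> 0" "i \<in> R"
    and ok: "\<And>e. e \<in> row_items R \<rho> l p h \<beta> b \<Longrightarrow> item_ok N y e"
  shows "\<bar>lform N (\<rho> i) y - p i\<bar> \<le> b / l"
proof -
  have "s * (l * (lform N (\<rho> i) y - p i)) \<le> b" if s: "s = 1 \<or> s = -1" for s
  proof -
    have "Item (\<lambda>c. s * l * \<rho> i c) (s * l * p i) h \<beta> b \<in> row_items R \<rho> l p h \<beta> b"
      using s assms(3) by (auto simp: row_items_def)
    then have "s * l * lform N (\<rho> i) y - s * l * p i \<le> b"
      using ok[of "Item (\<lambda>c. s * l * \<rho> i c) (s * l * p i) h \<beta> b"] assms(2)
      by (auto simp: item_ok_def lform_scale split: if_splits)
    then show ?thesis by (simp add: algebra_simps)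
  qed
  from this[of 1] this[of "-1"] have "\<bar>l * (lform N (\<rho> i) y - p i)\<bar> \<le> b" by simp
  then show ?thesis using assms(1) by (simp add: abs_mult pos_le_divide_eq mult.commute)
qed

lemma row_blockers_bound:
  assumes "u \<ge> 0" "i \<in> R" "\<forall>j\<in>N. \<bar>y j\<bar> \<le> 1"
    and ok: "\<And>g. g \<in> row_blockers R \<rho> p u \<Longrightarrow> blocker_ok N y g"
  shows "\<bar>lform N (\<rho> i) y - p i\<bar> \<le> 2 * u"
proof -
  have "blocker_ok N y (Blocker (\<rho> i) (p i) u)"
    using ok assms(2) by (simp add: row_blockers_def)
  moreover have "refines N y y" using assms(3) by (simp add: refines_def)
  ultimately show ?thesis using assms(1) by (auto simp: blocker_ok_def split: if_splits)
qed

text \<open>In phase \<open>j\<close> at most \<open>m / 4 ^ j\<close> coordinates are alive, so light rows have length of order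
  \<open>k / 4 ^ j\<close>. Scaling the rows by \<open>2 ^ j / sqrt k\<close> therefore makes their energy constant, and the
  deviations \<open>(j + 1) * sqrt k / 2 ^ j\<close> of the phases form a convergent series. The weights
  \<open>1 / (2 * m * 2 ^ j)\<close> keep the total potential below 4 over all phases.\<close>

lemma walk_rows_phase:
  fixes \<rho> :: "'r \<Rightarrow> 'c \<Rightarrow> real" and k m j :: nat
  assumes fin: "finite N" "finite E" "finite G" "finite R" and R: "card R = m" "m > 0" and \<eta>: "\<eta> > 0"
    and \<rho>: "\<And>i c. i \<in> R \<Longrightarrow> c \<in> N \<Longrightarrow> \<bar>\<rho> i c\<bar> \<le> 1"
    and spread: "\<And>S. S \<subseteq> N \<Longrightarrow>
      16 * card {i\<in>R. (\<Sum>c\<in>S. \<bar>\<rho> i c\<bar>) > 64 * (real k * card S / m + sqrt k)} \<le> card S"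
    and adm: "\<And>e. e \<in> E \<Longrightarrow> admissible N e"
    and strong: "\<And>e. e \<in> E \<Longrightarrow> wt e * exp (bnd e - 5 * thr e) > 4"
    and H: "\<And>S. S \<subseteq> N \<Longrightarrow> 8 * (card {e\<in>E. heavy S e} + card {g\<in>G. bheavy S g}) \<le> card S"
    and j: "4 ^ j < sqrt k"
    and st: "walk_state N E G \<eta> (4 - 2 / 2 ^ j) x" and al: "real (card (alive N x)) \<le> m / 4 ^ j"
  shows "\<exists>y. walk_state N E G \<eta> (4 - 2 / 2 ^ Suc j) y \<and> real (card (alive N y)) \<le> m / 4 ^ Suc j \<and>
           (\<forall>i\<in>R. \<bar>lform N (\<rho> i) y - lform N (\<rho> i) x\<bar> \<le> 140 * (j + 1) / 2 ^ j * sqrt k)"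
proof -
  define p where "p i = lform N (\<rho> i) x" for i
  define l where "l = 2 ^ j / (20 * sqrt k)"
  define \<beta> where "\<beta> = 1 / (2 * real m * 2 ^ j)"
  define b where "b = 7 * (real j + 1)"
  define u where "u = 128 * real k / 4 ^ j"
  define h :: real where "h = 8 / 25"
  define E' where "E' = row_items R \<rho> l p h \<beta> b"
  have sk: "sqrt k > 0" using j by (smt (verit) zero_less_power)
  then have k: "real k > 0" by simp
  have "(2::real) ^ j \<le> 4 ^ j" by (intro power_mono) auto
  then have l: "0 < l" "l \<le> 1 / 20" using sk j by (auto simp: l_def field_simps)
  have four: "((2::real) ^ j)\<^sup>2 = 4 ^ j" by (simp add: power2_eq_square flip: power_mult_distrib)
  have lu: "h = l\<^sup>2 * u"
    using k by (simp add: h_def l_def u_def power_divide power_mult_distrib four field_simps)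
  have \<beta>: "\<beta> > 0" using R by (simp add: \<beta>_def)
  have b: "b \<ge> 0" by (simp add: b_def)
  have x: "\<forall>j\<in>N. \<bar>x j\<bar> \<le> 1" using st by (simp add: walk_state_def)
  have finE': "finite E'" using fin by (simp add: E'_def)
  have adm': "admissible N e" if "e \<in> E \<union> E'" for e
  proof (cases "e \<in> E")
    case True
    then show ?thesis by (rule adm)
  next
    case False
    then have e: "e \<in> row_items R \<rho> l p h \<beta> b" using that by (simp add: E'_def)
    show ?thesis by (rule admissible_row_items[OF less_imp_le[OF \<beta>] b l _ e]) (rule \<rho>)
  qed
  have "walk_state N (E \<union> E') G \<eta> (4 - 2 / 2 ^ j + (\<Sum>e\<in>E'. wt e)) x"
  proof (rule walk_state_add_items[OF fin(1,2) finE' st])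
    fix e assume "e \<in> E'"
    then obtain s i where "e = Item (\<lambda>c. s * l * \<rho> i c) (s * l * p i) h \<beta> b"
      unfolding E'_def by (rule row_items_cases)
    then show "wt e \<ge> 0 \<and> bnd e \<ge> 0 \<and> lform N (form e) x = offs e"
      using \<beta> b by (simp add: p_def lform_scale)
  qed
  moreover have "(\<Sum>e\<in>E'. wt e) \<le> 1 / 2 ^ j"
    using sum_wt_row_items_le[OF fin(4), of \<beta> \<rho> l p h b] \<beta> R by (simp add: E'_def \<beta>_def)
  ultimately have st': "walk_state N (E \<union> E') G \<eta> (4 - 2 / 2 ^ Suc j) x"
    by (auto simp: walk_state_def)
  have Hall: "4 * (card {e\<in>E \<union> E'. heavy S e} + card {g\<in>G. bheavy S g}) \<le> card S"
    if S: "S \<subseteq> alive N x" for S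
  proof -
    have SN: "S \<subseteq> N" using S by (auto simp: alive_def)
    have "finite (alive N x)" using fin by (simp add: alive_def)
    then have "card S \<le> card (alive N x)" using S by (intro card_mono)
    then have "real (card S) \<le> m / 4 ^ j" using al by linarith
    then have "real k * card S / m \<le> real k * (m / 4 ^ j) / m"
      by (intro divide_right_mono mult_left_mono) auto
    also have "\<dots> = real k / 4 ^ j" using R by simp
    finally have 1: "real k * card S / m \<le> real k / 4 ^ j" .
    have "sqrt k * 4 ^ j \<le> sqrt k * sqrt k" using j sk by (intro mult_left_mono) auto
    then have "sqrt k \<le> real k / 4 ^ j" by (simp add: pos_le_divide_eq)
    then have u: "64 * (real k * card S / m + sqrt k) \<le> u" using 1 by (simp add: u_def)
    have "16 * card {i\<in>R. (\<Sum>c\<in>S. \<bar>\<rho> i c\<bar>) > u}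
        \<le> 16 * card {i\<in>R. (\<Sum>c\<in>S. \<bar>\<rho> i c\<bar>) > 64 * (real k * card S / m + sqrt k)}"
      using fin u by (intro mult_le_mono2 card_mono) auto
    also have "\<dots> \<le> card S" by (rule spread[OF SN])
    finally have "16 * card {i\<in>R. (\<Sum>c\<in>S. \<bar>\<rho> i c\<bar>) > u} \<le> card S" .
    moreover have "card {e\<in>E'. heavy S e} \<le> 2 * card {i\<in>R. (\<Sum>c\<in>S. \<bar>\<rho> i c\<bar>) > u}"
      unfolding E'_def using fin \<rho> SN by (intro card_heavy_row_items_le l lu) auto
    moreover have "card {e\<in>E \<union> E'. heavy S e} \<le> card {e\<in>E. heavy S e} + card {e\<in>E'. heavy S e}"
    proof -
      have "{e\<in>E \<union> E'. heavy S e} = {e\<in>E. heavy S e} \<union> {e\<in>E'. heavy S e}" by auto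
      then show ?thesis by (simp add: card_Un_le)
    qed
    ultimately show ?thesis using H[OF SN] by (auto simp: algebra_simps)
  qed
  have tight: "4 * real (card X) \<le> m / 4 ^ Suc j"
    if X: "X \<subseteq> E \<union> E'" "(\<Sum>e\<in>X. wt e * exp (bnd e - 5 * thr e)) \<le> 4 - 2 / 2 ^ Suc j" for X
  proof -
    have finX: "finite X" using X fin finE' by (meson finite_UnI finite_subset)
    have wt0: "wt e \<ge> 0" if "e \<in> X" for e using adm' X that by (auto simp: admissible_def)
    have le4: "(\<Sum>e\<in>X. wt e * exp (bnd e - 5 * thr e)) \<le> 4" using X(2) by (smt (verit) divide_nonneg_nonneg zero_le_power)
    have "e \<notin> E" if e: "e \<in> X" for e
    proof
      assume "e \<in> E"
      have "wt e * exp (bnd e - 5 * thr e) \<le> (\<Sum>e\<in>X. wt e * exp (bnd e - 5 * thr e))"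
        using finX e wt0 by (intro member_le_sum) auto
      then show False using strong[OF \<open>e \<in> E\<close>] le4 by linarith
    qed
    then have XE': "X \<subseteq> E'" using X by auto
    define q :: real where "q = 128 ^ (j + 1)"
    have "real (card X) * (\<beta> * q) = (\<Sum>e\<in>X. \<beta> * q)" by simp
    also have "\<dots> \<le> (\<Sum>e\<in>X. wt e * exp (bnd e - 5 * thr e))"
    proof (rule sum_mono)
      fix e assume "e \<in> X"
      then have e: "wt e = \<beta>" "bnd e = b" "thr e = h" using XE' by (auto simp: E'_def row_items_def)
      have "(128::real) \<le> 2.7 ^ 5" by (simp add: power_divide)
      also have "\<dots> \<le> exp 1 ^ 5"
      proof (rule power_mono)
        show "2.7 \<le> exp (1::real)"
          using exp_lower_Taylor_quadratic[of 1] e_approx_32 by (simp add: abs_if split: if_splits)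
      qed simp
      also have "\<dots> = exp (5::real)" by (simp flip: exp_of_nat_mult)
      finally have "q \<le> exp 5 ^ (j + 1)" unfolding q_def by (rule power_mono) simp
      also have "\<dots> = exp (5 * (real j + 1))"
        using exp_of_nat_mult[of "j + 1" "5::real"] by (simp add: algebra_simps)
      also have "\<dots> \<le> exp (b - 5 * h)" by (simp add: b_def h_def)
      finally show "\<beta> * q \<le> wt e * exp (bnd e - 5 * thr e)" using e \<beta> by simp
    qed
    also have "\<dots> \<le> 4" by (rule le4)
    finally have "4 * real (card X) \<le> 16 / (\<beta> * q)"
      using \<beta> by (simp add: q_def field_simps)
    also have "\<dots> = 32 * m * 2 ^ j / 128 ^ (j + 1)" by (simp add: \<beta>_def q_def)
    also have "\<dots> \<le> m / 4 ^ Suc j"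
    proof -
      have "(8::real) ^ j \<le> 128 ^ j" by (intro power_mono) auto
      moreover have "(8::real) ^ j = 2 ^ j * 4 ^ j" by (simp flip: power_mult_distrib)
      ultimately have "(2::real) ^ j * 4 ^ j \<le> 128 ^ j" by simp
      then have "real m * (2 ^ j * 4 ^ j) \<le> real m * 128 ^ j" by (intro mult_left_mono) auto
      then show ?thesis by (simp add: field_simps)
    qed
    finally show ?thesis .
  qed
  have "\<exists>y. walk_state N (E \<union> E') G \<eta> (4 - 2 / 2 ^ Suc j) y \<and> refines N x y \<and>
        real (card (alive N y)) \<le> m / 4 ^ Suc j"
  proof (rule walk_phase[OF fin(1) _ fin(3) \<eta> adm' st'])
    show "finite (E \<union> E')" using fin finE' by simp
    show "0 \<le> real m / 4 ^ Suc j" by simp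
  qed (use Hall tight in auto)
  then obtain y where y: "walk_state N (E \<union> E') G \<eta> (4 - 2 / 2 ^ Suc j) y"
      "real (card (alive N y)) \<le> m / 4 ^ Suc j"
    by blast
  have "walk_state N E G \<eta> (4 - 2 / 2 ^ Suc j) y"
    by (rule walk_state_subset[OF _ _ _ _ y(1)]) (use fin finE' adm' in \<open>auto simp: admissible_def\<close>)
  moreover have "\<bar>lform N (\<rho> i) y - lform N (\<rho> i) x\<bar> \<le> 140 * (j + 1) / 2 ^ j * sqrt k" if i: "i \<in> R" for i
  proof -
    have "\<bar>lform N (\<rho> i) y - p i\<bar> \<le> b / l"
      using y(1) by (intro row_items_bound[OF l(1) b i, where h = h and \<beta> = \<beta>])
        (auto simp: walk_state_def E'_def)
    then show ?thesis by (simp add: p_def b_def l_def algebra_simps)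
  qed
  ultimately show ?thesis using y(2) by blast
qed

theorem spread_rows_coloring:
  fixes \<rho> :: "'r \<Rightarrow> 'c \<Rightarrow> real" and k m :: nat
  assumes fin: "finite N" "finite E" "finite G" "finite R" and R: "card R = m" "m > 0"
    and NR: "card N \<le> m"
    and \<rho>: "\<And>i c. i \<in> R \<Longrightarrow> c \<in> N \<Longrightarrow> \<bar>\<rho> i c\<bar> \<le> 1"
    and spread: "\<And>S. S \<subseteq> N \<Longrightarrow>
      16 * card {i\<in>R. (\<Sum>c\<in>S. \<bar>\<rho> i c\<bar>) > 64 * (real k * card S / m + sqrt k)} \<le> card S"
    and adm: "\<And>e. e \<in> E \<Longrightarrow> admissible N e"
    and strong: "\<And>e. e \<in> E \<Longrightarrow> wt e * exp (bnd e - 5 * thr e) > 4"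
    and wt: "(\<Sum>e\<in>E. wt e) \<le> 1"
    and offs: "\<And>e. e \<in> E \<Longrightarrow> offs e = 0" "\<And>g. g \<in> G \<Longrightarrow> boffs g = 0"
    and H: "\<And>S. S \<subseteq> N \<Longrightarrow> 8 * (card {e\<in>E. heavy S e} + card {g\<in>G. bheavy S g}) \<le> card S"
  shows "\<exists>x. (\<forall>j\<in>N. \<bar>x j\<bar> = 1) \<and> (\<forall>e\<in>E. item_ok N x e) \<and> (\<forall>g\<in>G. blocker_ok N x g) \<and>
           (\<forall>i\<in>R. \<bar>lform N (\<rho> i) x\<bar> \<le> 816 * sqrt k)"
proof -
  define \<eta> where "\<eta> = 1 / (real (card N) + 1)"
  have \<eta>: "\<eta> > 0" "\<eta> * card N \<le> 1" by (auto simp: \<eta>_def field_simps)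
  have z: "lform N a (\<lambda>_. 0) = 0" for a by (simp add: lform_def)
  have "walk_state N {} {} \<eta> 1 (\<lambda>_. 0)"
    using \<eta> by (simp add: walk_state_def total_pot_def slack_def)
  then have "walk_state N ({} \<union> E) {} \<eta> (1 + (\<Sum>e\<in>E. wt e)) (\<lambda>_. 0)"
    using fin adm offs by (intro walk_state_add_items) (auto simp: admissible_def z)
  then have "walk_state N E ({} \<union> G) \<eta> (1 + (\<Sum>e\<in>E. wt e)) (\<lambda>_. 0)"
    using fin offs by (intro walk_state_add_blockers) (auto simp: z)
  then have st0: "walk_state N E G \<eta> 2 (\<lambda>_. 0)" using wt by (auto simp: walk_state_def)
  have phases: "\<exists>x. walk_state N E G \<eta> (4 - 2 / 2 ^ j) x \<and> real (card (alive N x)) \<le> m / 4 ^ j \<and>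
      (\<forall>i\<in>R. \<bar>lform N (\<rho> i) x\<bar> \<le> 140 * (4 - 2 * (real j + 2) / 2 ^ j) * sqrt k)"
    if "\<forall>j'<j. 4 ^ j' < sqrt k" for j
    using that
  proof (induction j)
    case 0
    have "alive N (\<lambda>_. 0) = N" by (auto simp: alive_def)
    then show ?case using st0 NR by (intro exI[of _ "\<lambda>_. 0"]) (auto simp: z)
  next
    case (Suc j)
    then obtain x where x: "walk_state N E G \<eta> (4 - 2 / 2 ^ j) x" "real (card (alive N x)) \<le> m / 4 ^ j"
      "\<forall>i\<in>R. \<bar>lform N (\<rho> i) x\<bar> \<le> 140 * (4 - 2 * (real j + 2) / 2 ^ j) * sqrt k" by auto
    have "4 ^ j < sqrt k" using Suc.prems by simp
    then have "\<exists>y. walk_state N E G \<eta> (4 - 2 / 2 ^ Suc j) y \<and> real (card (alive N y)) \<le> m / 4 ^ Suc j \<and>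
           (\<forall>i\<in>R. \<bar>lform N (\<rho> i) y - lform N (\<rho> i) x\<bar> \<le> 140 * (j + 1) / 2 ^ j * sqrt k)"
      by (intro walk_rows_phase[OF fin R \<eta>(1) \<rho> spread adm strong H _ x(1,2)])
    then obtain y where y: "walk_state N E G \<eta> (4 - 2 / 2 ^ Suc j) y" "real (card (alive N y)) \<le> m / 4 ^ Suc j"
        "\<forall>i\<in>R. \<bar>lform N (\<rho> i) y - lform N (\<rho> i) x\<bar> \<le> 140 * (j + 1) / 2 ^ j * sqrt k" by blast
    have "\<bar>lform N (\<rho> i) y\<bar> \<le> 140 * (4 - 2 * (real (Suc j) + 2) / 2 ^ Suc j) * sqrt k" if i: "i \<in> R" for i
    proof -
      have "\<bar>lform N (\<rho> i) y\<bar> \<le> 140 * (4 - 2 * (real j + 2) / 2 ^ j) * sqrt k + 140 * (j + 1) / 2 ^ j * sqrt k"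
        using bspec[OF x(3) i] bspec[OF y(3) i] by linarith
      also have "\<dots> = 140 * (4 - 2 * (real (Suc j) + 2) / 2 ^ Suc j) * sqrt k"
        by (simp add: field_simps)
      finally show ?thesis .
    qed
    then show ?case using y by blast
  qed
  have ex: "\<exists>j. sqrt k \<le> 4 ^ j"
    using real_arch_pow[of 4 "sqrt k"] by (auto intro: less_imp_le)
  define J where "J = (LEAST j. sqrt k \<le> 4 ^ j)"
  have J: "sqrt k \<le> 4 ^ J" unfolding J_def using ex by (rule LeastI_ex)
  have "\<forall>j'<J. 4 ^ j' < sqrt k" unfolding J_def using not_less_Least not_le_imp_less by blast
  from phases[OF this] obtain x where x: "walk_state N E G \<eta> (4 - 2 / 2 ^ J) x"
      "real (card (alive N x)) \<le> m / 4 ^ J"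
      "\<forall>i\<in>R. \<bar>lform N (\<rho> i) x\<bar> \<le> 140 * (4 - 2 * (real J + 2) / 2 ^ J) * sqrt k"
    by blast
  define G' where "G' = row_blockers R \<rho> (\<lambda>i. lform N (\<rho> i) x) (128 * sqrt k)"
  have st': "walk_state N E (G \<union> G') \<eta> (4 - 2 / 2 ^ J) x"
    using fin x(1) by (intro walk_state_add_blockers) (auto simp: G'_def row_blockers_def)
  have Hall: "4 * (card {e\<in>E. heavy S e} + card {g\<in>G \<union> G'. bheavy S g}) \<le> card S"
    if S: "S \<subseteq> alive N x" for S
  proof -
    have SN: "S \<subseteq> N" using S by (auto simp: alive_def)
    have "finite (alive N x)" using fin by (simp add: alive_def)
    then have "card S \<le> card (alive N x)" using S by (intro card_mono)
    then have "real (card S) \<le> m / 4 ^ J" using x(2) by linarith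
    then have "real k * card S / m \<le> real k * (m / 4 ^ J) / m"
      by (intro divide_right_mono mult_left_mono) auto
    also have "\<dots> = sqrt k * sqrt k / 4 ^ J" using R by simp
    also have "\<dots> \<le> sqrt k * 4 ^ J / 4 ^ J" using J by (intro divide_right_mono mult_left_mono) auto
    finally have u: "64 * (real k * card S / m + sqrt k) \<le> 128 * sqrt k" by simp
    have "16 * card {i\<in>R. (\<Sum>c\<in>S. \<bar>\<rho> i c\<bar>) > 128 * sqrt k}
        \<le> 16 * card {i\<in>R. (\<Sum>c\<in>S. \<bar>\<rho> i c\<bar>) > 64 * (real k * card S / m + sqrt k)}"
      using fin u by (intro mult_le_mono2 card_mono) auto
    also have "\<dots> \<le> card S" by (rule spread[OF SN])
    finally have "16 * card {i\<in>R. (\<Sum>c\<in>S. \<bar>\<rho> i c\<bar>) > 128 * sqrt k} \<le> card S" .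
    moreover have "card {g\<in>G'. bheavy S g} \<le> card {i\<in>R. (\<Sum>c\<in>S. \<bar>\<rho> i c\<bar>) > 128 * sqrt k}"
      unfolding G'_def using fin by (intro card_bheavy_row_blockers_le)
    moreover have "card {g\<in>G \<union> G'. bheavy S g} \<le> card {g\<in>G. bheavy S g} + card {g\<in>G'. bheavy S g}"
    proof -
      have "{g\<in>G \<union> G'. bheavy S g} = {g\<in>G. bheavy S g} \<union> {g\<in>G'. bheavy S g}" by auto
      then show ?thesis by (simp add: card_Un_le)
    qed
    ultimately show ?thesis using H[OF SN] by (auto simp: algebra_simps)
  qed
  have tight: "4 * real (card X) \<le> 0"
    if X: "X \<subseteq> E" "(\<Sum>e\<in>X. wt e * exp (bnd e - 5 * thr e)) \<le> 4 - 2 / 2 ^ J" for X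
  proof -
    have finX: "finite X" using X fin by (meson finite_subset)
    have le4: "(\<Sum>e\<in>X. wt e * exp (bnd e - 5 * thr e)) \<le> 4" using X(2) by (smt (verit) divide_nonneg_nonneg zero_le_power)
    have "X = {}"
    proof (rule ccontr)
      assume "X \<noteq> {}"
      then obtain e where e: "e \<in> X" by blast
      have "wt e * exp (bnd e - 5 * thr e) \<le> (\<Sum>e\<in>X. wt e * exp (bnd e - 5 * thr e))"
        using finX e X adm by (intro member_le_sum) (auto simp: admissible_def)
      then show False using strong[of e] e X le4 by fastforce
    qed
    then show ?thesis by simp
  qed
  have "\<exists>y. walk_state N E (G \<union> G') \<eta> (4 - 2 / 2 ^ J) y \<and> refines N x y \<and> real (card (alive N y)) \<le> 0"
  proof (rule walk_phase[OF fin(1,2) _ \<eta>(1) adm st' order_refl])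
    show "finite (G \<union> G')" using fin by (simp add: G'_def)
  qed (use Hall tight in auto)
  then obtain y where y: "walk_state N E (G \<union> G') \<eta> (4 - 2 / 2 ^ J) y" "real (card (alive N y)) \<le> 0"
    by blast
  have "finite (alive N y)" using fin by (simp add: alive_def)
  then have "alive N y = {}" using y(2) by simp
  then have "\<forall>j\<in>N. \<bar>y j\<bar> = 1" using y(1) by (force simp: alive_def walk_state_def)
  moreover have "\<bar>lform N (\<rho> i) y\<bar> \<le> 816 * sqrt k" if i: "i \<in> R" for i
  proof -
    have "\<bar>lform N (\<rho> i) y - lform N (\<rho> i) x\<bar> \<le> 2 * (128 * sqrt k)"
      using y(1) by (intro row_blockers_bound[OF _ i, where p = "\<lambda>i. lform N (\<rho> i) x"])
        (auto simp: walk_state_def G'_def)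
    moreover have "140 * (4 - 2 * (real J + 2) / 2 ^ J) * sqrt k \<le> 140 * 4 * sqrt k"
      by (intro mult_right_mono mult_left_mono) auto
    ultimately show ?thesis using bspec[OF x(3) i] by linarith
  qed
  ultimately show ?thesis using y(1) by (intro exI[of _ y]) (auto simp: walk_state_def)
qed

section \<open>Random incidence matrices are spread\<close>

lemma binomial_diff_mult_power_le:
  fixes m k d :: nat
  assumes "d \<le> k" "k \<le> m"
  shows "((m - d) choose (k - d)) * m ^ d \<le> (m choose k) * k ^ d"
  using assms(1)
proof (induction d)
  case 0
  then show ?case by simp
next
  case (Suc d)
  let ?c' = "(m - Suc d) choose (k - Suc d)" and ?c = "(m - d) choose (k - d)"
  have kd: "d < k" "d < m" using Suc.prems assms by auto
  have abs: "(m - d) * ?c' = (k - d) * ?c"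
    using times_binomial_minus1_eq[of "k - d" "m - d"] kd by simp
  have frac: "(k - d) * m \<le> k * (m - d)"
  proof -
    have "d * k \<le> d * m" using assms by simp
    then show ?thesis
      unfolding diff_mult_distrib diff_mult_distrib2 mult.commute[of k d] by (rule diff_le_mono2)
  qed
  have "(m - d) * (?c' * m ^ Suc d) = (k - d) * m * (?c * m ^ d)"
    using abs by (metis (no_types, lifting) mult.assoc mult.commute power_Suc)
  also have "\<dots> \<le> k * (m - d) * ((m choose k) * k ^ d)"
    by (rule mult_le_mono[OF frac]) (use Suc in simp)
  finally have "(m - d) * (?c' * m ^ Suc d) \<le> (m - d) * ((m choose k) * k ^ Suc d)"
    by (simp add: mult_ac)
  then show ?case using kd by simp
qed

definition ksubsets :: "nat \<Rightarrow> nat \<Rightarrow> nat set set" where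
  "ksubsets m k = {S. S \<subseteq> {..<m} \<and> card S = k}"

lemma finite_ksubsets [simp]: "finite (ksubsets m k)"
  unfolding ksubsets_def by (rule finite_subset[of _ "Pow {..<m}"]) auto

lemma card_ksubsets [simp]: "card (ksubsets m k) = m choose k"
  unfolding ksubsets_def by (subst n_subsets) auto

lemma ksubsets_nonempty: "k \<le> m \<Longrightarrow> ksubsets m k \<noteq> {}"
  using card_ksubsets[of m k] by (metis binomial_eq_0_iff card.empty not_le)

lemma card_ksubsets_superset_le:
  assumes "k \<le> m" "0 < m" and T: "T \<subseteq> {..<m}"
  shows "real (card {S\<in>ksubsets m k. T \<subseteq> S}) \<le> (m choose k) * (k / m) ^ card T"
proof (cases "card T \<le> k")
  case False
  have "card T \<le> k" if "S \<in> ksubsets m k" "T \<subseteq> S" for S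
    using that card_mono[of S T] by (auto simp: ksubsets_def finite_subset)
  then have "{S\<in>ksubsets m k. T \<subseteq> S} = {}" using False by auto
  then have "card {S\<in>ksubsets m k. T \<subseteq> S} = 0" by (simp only: card.empty)
  then show ?thesis by (simp only: of_nat_0) simp
next
  case True
  have finT: "finite T" using T finite_subset by blast
  have "card {S\<in>ksubsets m k. T \<subseteq> S} \<le> card {S. S \<subseteq> {..<m} - T \<and> card S = k - card T}"
  proof (rule card_inj_on_le[where f = "\<lambda>S. S - T"])
    show "inj_on (\<lambda>S. S - T) {S\<in>ksubsets m k. T \<subseteq> S}" by (rule inj_onI) auto
    show "(\<lambda>S. S - T) ` {S\<in>ksubsets m k. T \<subseteq> S} \<subseteq> {S. S \<subseteq> {..<m} - T \<and> card S = k - card T}"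
      using finT by (auto simp: ksubsets_def card_Diff_subset)
  qed (rule finite_subset[of _ "Pow {..<m}"], auto)
  also have "\<dots> = (m - card T) choose (k - card T)"
    using T finT by (subst n_subsets) (auto simp: card_Diff_subset)
  finally have "card {S\<in>ksubsets m k. T \<subseteq> S} * m ^ card T \<le> (m choose k) * k ^ card T"
    using binomial_diff_mult_power_le[OF True assms(1)] by (meson le_trans mult_le_mono1)
  then have "real (card {S\<in>ksubsets m k. T \<subseteq> S} * m ^ card T) \<le> real ((m choose k) * k ^ card T)"
    by (rule of_nat_mono)
  then show ?thesis using assms(2) by (simp add: power_divide pos_le_divide_eq)
qed

lemma power_card_eq_sum_Pow:
  fixes y :: real
  assumes "finite R"
  shows "(1 + y) ^ card R = (\<Sum>X\<in>Pow R. y ^ card X)"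
proof -
  have "(\<Prod>x\<in>R. y + 1) = (\<Sum>X\<in>Pow R. (\<Prod>x\<in>X. y) * (\<Prod>x\<in>R - X. 1))"
    by (rule prod_add[OF assms])
  then show ?thesis by (simp add: add.commute)
qed

text \<open>Expanding the power over subsets \<open>T\<close> of \<open>R \<inter> S\<close> reduces the claim to
  \<open>P (T \<subseteq> S) \<le> (k / m) ^ card T\<close>.\<close>

lemma expectation_power_card_inter_le:
  fixes y :: real
  assumes "k \<le> m" "0 < m" and R: "R \<subseteq> {..<m}" and y: "y \<ge> 0"
  shows "measure_pmf.expectation (pmf_of_set (ksubsets m k)) (\<lambda>S. (1 + y) ^ card (R \<inter> S))
           \<le> exp (y * card R * k / m)"
proof -
  have finR: "finite R" using R finite_subset by blast
  have pos: "real (m choose k) > 0" using assms by simp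
  have "(\<Sum>S\<in>ksubsets m k. (1 + y) ^ card (R \<inter> S)) =
      (\<Sum>S\<in>ksubsets m k. \<Sum>X\<in>Pow R. if X \<subseteq> S then y ^ card X else 0)"
  proof (rule sum.cong[OF refl])
    fix S
    have "(1 + y) ^ card (R \<inter> S) = (\<Sum>X\<in>Pow (R \<inter> S). y ^ card X)"
      using finR by (intro power_card_eq_sum_Pow) auto
    also have "\<dots> = (\<Sum>X\<in>Pow R. if X \<subseteq> S then y ^ card X else 0)"
      using finR by (intro sum.mono_neutral_cong_left) auto
    finally show "(1 + y) ^ card (R \<inter> S) = (\<Sum>X\<in>Pow R. if X \<subseteq> S then y ^ card X else 0)" .
  qed
  also have "\<dots> = (\<Sum>X\<in>Pow R. \<Sum>S\<in>ksubsets m k. if X \<subseteq> S then y ^ card X else 0)"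
    by (rule sum.swap)
  also have "\<dots> = (\<Sum>X\<in>Pow R. y ^ card X * card {S\<in>ksubsets m k. X \<subseteq> S})"
    by (intro sum.cong refl) (simp add: sum.If_cases Int_def mult.commute)
  also have "\<dots> \<le> (\<Sum>X\<in>Pow R. y ^ card X * ((m choose k) * (k / m) ^ card X))"
    using assms by (intro sum_mono mult_left_mono card_ksubsets_superset_le) auto
  also have "\<dots> = (m choose k) * (\<Sum>X\<in>Pow R. (y * (k / m)) ^ card X)"
    unfolding sum_distrib_left by (intro sum.cong refl) (simp only: power_mult_distrib mult_ac)
  also have "\<dots> = (m choose k) * (1 + y * (k / m)) ^ card R"
    using power_card_eq_sum_Pow[OF finR] by simp
  also have "\<dots> \<le> (m choose k) * exp (y * (k / m)) ^ card R"
    using y by (intro mult_left_mono power_mono exp_ge_add_one_self) auto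
  also have "exp (y * (k / m)) ^ card R = exp (y * card R * k / m)"
    by (simp flip: exp_of_nat_mult add: mult_ac)
  finally show ?thesis
    using pos assms ksubsets_nonempty[OF assms(1)]
    by (subst integral_pmf_of_set) (auto simp: pos_divide_le_eq mult.commute)
qed

lemma incidence_tail_bound:
  fixes \<rho> D :: real and n :: nat
  assumes km: "k \<le> m" "0 < m" and R: "R \<subseteq> {..<m}" and S: "S \<subseteq> {..<n}" and \<rho>: "\<rho> \<ge> 1"
  shows "measure_pmf.prob (Pi_pmf {..<n} {} (\<lambda>_. pmf_of_set (ksubsets m k)))
           {E. real (\<Sum>j\<in>S. card (R \<inter> E j)) \<ge> D}
         \<le> exp ((\<rho> - 1) * card R * k / m * card S - D * ln \<rho>)"
proof -
  let ?p = "pmf_of_set (ksubsets m k)"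
  let ?P = "Pi_pmf {..<n} {} (\<lambda>_. ?p)"
  define f where "f j = (\<lambda>X :: nat set. if j \<in> S then \<rho> ^ card (R \<inter> X) else 1)" for j
  define \<mu> where "\<mu> = exp ((\<rho> - 1) * card R * k / m)"
  have set_p: "set_pmf ?p = ksubsets m k" using ksubsets_nonempty[OF km(1)] by simp
  have int: "integrable (measure_pmf ?p) g" for g :: "_ \<Rightarrow> real"
    by (rule integrable_measure_pmf_finite) (simp add: set_p)
  have f0: "f j X \<ge> 0" for j X using \<rho> by (simp add: f_def)
  have prod: "(\<Prod>j<n. f j (E j)) = \<rho> ^ (\<Sum>j\<in>S. card (R \<inter> E j))" for E
  proof -
    have "(\<Prod>j<n. f j (E j)) = (\<Prod>j\<in>S. \<rho> ^ card (R \<inter> E j))"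
      using S by (intro prod.mono_neutral_cong_right) (auto simp: f_def)
    then show ?thesis by (simp add: power_sum)
  qed
  have "measure_pmf.expectation ?P (\<lambda>E. \<Prod>j<n. f j (E j)) =
      (\<Prod>j<n. measure_pmf.expectation ?p (f j))"
    using f0 by (intro expectation_prod_Pi_pmf int) auto
  also have "\<dots> \<le> (\<Prod>j<n. if j \<in> S then \<mu> else 1)"
  proof (rule prod_mono, intro conjI)
    fix j
    show "0 \<le> measure_pmf.expectation ?p (f j)"
      using f0 by (intro Bochner_Integration.integral_nonneg) auto
    show "measure_pmf.expectation ?p (f j) \<le> (if j \<in> S then \<mu> else 1)"
      using expectation_power_card_inter_le[OF km R, of "\<rho> - 1"] \<rho>
      by (auto simp: f_def \<mu>_def)
  qed
  also have "\<dots> = \<mu> ^ card S"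
  proof -
    have "(\<Prod>j<n. if j \<in> S then \<mu> else 1) = (\<Prod>j\<in>S. \<mu>)"
      using S by (intro prod.mono_neutral_cong_right) auto
    then show ?thesis by simp
  qed
  finally have ex: "measure_pmf.expectation ?P (\<lambda>E. \<Prod>j<n. f j (E j)) \<le> \<mu> ^ card S" .
  have "{E. real (\<Sum>j\<in>S. card (R \<inter> E j)) \<ge> D} \<subseteq>
      {E. (\<Prod>j<n. f j (E j)) \<ge> exp (D * ln \<rho>)}"
  proof
    fix E assume "E \<in> {E. real (\<Sum>j\<in>S. card (R \<inter> E j)) \<ge> D}"
    then have "D * ln \<rho> \<le> real (\<Sum>j\<in>S. card (R \<inter> E j)) * ln \<rho>"
      using \<rho> by (intro mult_right_mono) auto
    then have "exp (D * ln \<rho>) \<le> exp (real (\<Sum>j\<in>S. card (R \<inter> E j)) * ln \<rho>)" by simp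
    also have "\<dots> = \<rho> ^ (\<Sum>j\<in>S. card (R \<inter> E j))"
      using \<rho> by (subst exp_of_nat_mult) (simp only: exp_ln)
    finally show "E \<in> {E. (\<Prod>j<n. f j (E j)) \<ge> exp (D * ln \<rho>)}" by (simp add: prod)
  qed
  then have "measure_pmf.prob ?P {E. real (\<Sum>j\<in>S. card (R \<inter> E j)) \<ge> D} \<le>
      measure_pmf.prob ?P {E. (\<Prod>j<n. f j (E j)) \<ge> exp (D * ln \<rho>)}"
    by (intro measure_pmf.finite_measure_mono) auto
  also have "\<dots> \<le> measure_pmf.expectation ?P (\<lambda>E. \<Prod>j<n. f j (E j)) / exp (D * ln \<rho>)"
  proof -
    have "integrable (measure_pmf ?P) (\<lambda>E. \<Prod>j<n. f j (E j))"
      by (intro integrable_prod_Pi_pmf int) auto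
    then show ?thesis
      using integral_Markov_inequality_measure[of "measure_pmf ?P" "\<lambda>E. \<Prod>j<n. f j (E j)" "{}" "exp (D * ln \<rho>)"]
        f0 by (simp add: prod_nonneg)
  qed
  also have "\<dots> \<le> \<mu> ^ card S / exp (D * ln \<rho>)"
    by (intro divide_right_mono ex) simp
  also have "\<dots> = exp ((\<rho> - 1) * card R * k / m * card S - D * ln \<rho>)"
    by (simp add: \<mu>_def exp_diff mult.commute flip: exp_of_nat_mult)
  finally show ?thesis .
qed

lemma binomial_le_exp:
  fixes N m r s :: nat
  assumes "N \<le> m" "r \<le> s" "1 \<le> s" "s \<le> m"
  shows "real (N choose r) \<le> exp (s * (1 + ln (m / s)))"
proof -
  define z where "z = real s / m"
  have z: "0 < z" "z \<le> 1" using assms by (auto simp: z_def)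
  have "real (N choose r) * z ^ s \<le> real (N choose r) * z ^ r"
    using z assms by (intro mult_left_mono power_decreasing) auto
  also have "\<dots> \<le> (1 + z) ^ N"
  proof (cases "r \<le> N")
    case True
    have "real (N choose r) * z ^ r * 1 ^ (N - r) \<le> (\<Sum>i\<le>N. real (N choose i) * z ^ i * 1 ^ (N - i))"
      using True z by (intro member_le_sum) auto
    then show ?thesis using binomial_ring[of z 1 N] by (simp add: add.commute)
  next
    case False
    then show ?thesis using z by (simp add: binomial_eq_0)
  qed
  also have "\<dots> \<le> (1 + z) ^ m" using z assms by (intro power_increasing) auto
  also have "\<dots> \<le> exp z ^ m" using z by (intro power_mono exp_ge_add_one_self) auto
  also have "\<dots> = exp s" using assms by (simp add: z_def flip: exp_of_nat_mult)
  finally have "real (N choose r) \<le> exp s / z ^ s" using z by (simp add: pos_le_divide_eq)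
  also have "\<dots> = exp (s * (1 + ln (m / s)))"
  proof -
    have "exp (s * ln (m / s)) = (m / s) ^ s"
      using assms by (subst exp_of_nat_mult) (simp add: exp_ln)
    then show ?thesis by (simp add: z_def distrib_left exp_add power_divide)
  qed
  finally show ?thesis .
qed

lemma spread_exponent_bound:
  fixes a z :: real
  assumes "a \<ge> 1" "z \<ge> 1"
  shows "1 + ln z \<le> a * (1 + ln (1 + z / a))"
proof -
  have "0 < z / a" using assms by simp
  have "ln z = ln (z / a) + ln a" using assms by (simp add: ln_div)
  also have "\<dots> \<le> ln (1 + z / a) + (a - 1)"
    using assms \<open>0 < z / a\<close> by (intro add_mono ln_le_minus_one ln_mono) auto
  finally have "1 + ln z \<le> a + 1 * ln (1 + z / a)" by simp
  also have "\<dots> \<le> a + a * ln (1 + z / a)"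
    using assms by (intro add_left_mono mult_right_mono) auto
  finally show ?thesis by (simp add: distrib_left)
qed

lemma prob_UN_le_card_mult:
  fixes p :: "'a pmf" and B :: real
  assumes "finite I" "\<And>i. i \<in> I \<Longrightarrow> measure_pmf.prob p (A i) \<le> B"
  shows "measure_pmf.prob p (\<Union>i\<in>I. A i) \<le> card I * B"
proof -
  have "measure_pmf.prob p (\<Union>i\<in>I. A i) \<le> (\<Sum>i\<in>I. measure_pmf.prob p (A i))"
    using assms(1) by (intro measure_pmf.finite_measure_subadditive_finite) auto
  also have "\<dots> \<le> card I * B" using assms(2) by (rule sum_bounded_above)
  finally show ?thesis .
qed

definition spread_incidence :: "nat \<Rightarrow> nat \<Rightarrow> nat \<Rightarrow> (nat \<Rightarrow> nat set) \<Rightarrow> bool" where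
  "spread_incidence m n k E \<longleftrightarrow> (\<forall>S\<subseteq>{..<n}.
     16 * card {i. i < m \<and> real (card {j\<in>S. i \<in> E j}) > 64 * (real k * card S / m + sqrt k)} \<le> card S)"

lemma dense_pair_of_not_spread:
  assumes "\<not> spread_incidence m n k E" "0 < m"
  obtains s S R where "1 \<le> s" "s \<le> n" "S \<in> ksubsets n s" "R \<in> ksubsets m (s div 16 + 1)"
    "real (\<Sum>j\<in>S. card (R \<inter> E j)) \<ge> real (s div 16 + 1) * (64 * (real k * s / m + sqrt k))"
proof -
  define \<tau> where "\<tau> S = 64 * (real k * card S / m + sqrt k)" for S :: "nat set"
  define V where "V S = {i. i < m \<and> real (card {j\<in>S. i \<in> E j}) > \<tau> S}" for S
  obtain S where S: "S \<subseteq> {..<n}" "card S < 16 * card (V S)"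
    using assms(1) unfolding spread_incidence_def V_def \<tau>_def by (meson not_le)
  have finS: "finite S" using S finite_subset by blast
  have finV: "finite (V S)" by (simp add: V_def)
  have "card S \<noteq> 0"
  proof
    assume "card S = 0"
    then have "S = {}" using finS by simp
    then have "V S = {}" by (simp add: V_def \<tau>_def)
    then show False using S by simp
  qed
  moreover have "card S \<le> n" using S card_mono[of "{..<n}" S] by simp
  moreover have "S \<in> ksubsets n (card S)" using S by (simp add: ksubsets_def)
  moreover have "card S div 16 + 1 \<le> card (V S)" using S(2) by linarith
  then obtain R where R: "R \<subseteq> V S" "card R = card S div 16 + 1"
    by (rule obtain_subset_with_card_n)
  moreover have "R \<in> ksubsets m (card S div 16 + 1)" using R by (auto simp: ksubsets_def V_def)
  moreover have "real (\<Sum>j\<in>S. card (R \<inter> E j)) \<ge> real (card S div 16 + 1) * \<tau> S"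
  proof -
    have finR: "finite R" using R finV finite_subset by blast
    have "(\<Sum>j\<in>S. card (R \<inter> E j)) = (\<Sum>j\<in>S. \<Sum>i\<in>R. of_bool (i \<in> E j))"
      using finR by (intro sum.cong refl) (simp add: Int_def)
    also have "\<dots> = (\<Sum>i\<in>R. \<Sum>j\<in>S. of_bool (i \<in> E j))" by (rule sum.swap)
    also have "\<dots> = (\<Sum>i\<in>R. card {j\<in>S. i \<in> E j})"
      using finS by (intro sum.cong refl) (simp add: Int_def)
    finally have "real (\<Sum>j\<in>S. card (R \<inter> E j)) = (\<Sum>i\<in>R. real (card {j\<in>S. i \<in> E j}))" by simp
    also have "\<dots> \<ge> (\<Sum>i\<in>R. \<tau> S)" using R by (intro sum_mono) (auto simp: V_def)
    finally show ?thesis by (simp add: R(2))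
  qed
  ultimately show thesis using that[of "card S" S R] by (simp add: \<tau>_def)
qed

lemma prob_dense_pair_le:
  assumes k: "1 \<le> k" "k \<le> m" and s: "1 \<le> s" "s \<le> n" "n \<le> m"
    and S: "S \<in> ksubsets n s" and R: "R \<in> ksubsets m (s div 16 + 1)"
  shows "measure_pmf.prob (Pi_pmf {..<n} {} (\<lambda>_. pmf_of_set (ksubsets m k)))
      {E. real (\<Sum>j\<in>S. card (R \<inter> E j)) \<ge> real (s div 16 + 1) * (64 * (real k * s / m + sqrt k))}
    \<le> exp (- (4 * s * (1 + ln (m / s))))"
proof -
  define a where "a = sqrt k"
  define z where "z = real m / s"
  define r where "r = real (s div 16 + 1)"
  define \<rho> where "\<rho> = 64 * (1 + z / a)"
  define D where "D = r * (64 * (real k * s / m + sqrt k))"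
  have a: "a \<ge> 1" "a * a = k" using k by (auto simp: a_def)
  have z: "z \<ge> 1" using s by (simp add: z_def)
  have m: "0 < m" using s by simp
  have r: "r * 16 \<ge> s"
  proof -
    have "s \<le> (s div 16 + 1) * 16" by presburger
    then have "real s \<le> real ((s div 16 + 1) * 16)" by (rule of_nat_mono)
    then show ?thesis by (simp add: r_def)
  qed
  have \<rho>: "\<rho> \<ge> 64" using a z by (simp add: \<rho>_def)
  have D\<rho>: "D = \<rho> * (r * k / m * s)"
  proof -
    have "real k / z = real k * s / m" by (simp add: z_def)
    moreover have "real k / z + a = (1 + z / a) * (real k / z)"
      using a z by (simp add: field_simps)
    ultimately have "real k * s / m + a = (1 + z / a) * (real k * s / m)" by simp
    then show ?thesis by (simp add: D_def \<rho>_def a_def)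
  qed
  have Dge: "D \<ge> 4 * s * a"
  proof -
    have "s * (64 * a) \<le> (r * 16) * (64 * (real k * s / m + a))"
      using r a by (intro mult_mono) auto
    then show ?thesis by (simp add: D_def a_def)
  qed
  have ln64: "ln \<rho> - 1 \<ge> 1 + ln (1 + z / a)"
  proof -
    have "exp (2::real) = exp 1 * exp 1" by (simp flip: exp_add)
    also have "\<dots> \<le> 3 * 3" using exp_le by (intro mult_mono) auto
    finally have "2 \<le> ln (64::real)" by (subst ln_ge_iff) auto
    moreover have "1 + z / a > 0" using a z by (simp add: add_pos_nonneg)
    then have "ln \<rho> = ln 64 + ln (1 + z / a)" unfolding \<rho>_def by (intro ln_mult_pos) simp_all
    ultimately show ?thesis by linarith
  qed
  have D0: "D \<ge> 0" unfolding D_def r_def by simp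
  have "4 * s * (1 + ln z) \<le> 4 * s * (a * (1 + ln (1 + z / a)))"
    using spread_exponent_bound[OF a(1) z] by (intro mult_left_mono) auto
  also have "\<dots> \<le> D * (1 + ln (1 + z / a))"
    using Dge a z mult_right_mono[OF Dge, of "1 + ln (1 + z / a)"] by (simp add: mult_ac)
  also have "\<dots> \<le> D * (ln \<rho> - 1)" using ln64 D0 by (rule mult_left_mono)
  finally have main: "4 * s * (1 + ln z) \<le> D * (ln \<rho> - 1)" .
  have "measure_pmf.prob (Pi_pmf {..<n} {} (\<lambda>_. pmf_of_set (ksubsets m k)))
      {E. real (\<Sum>j\<in>S. card (R \<inter> E j)) \<ge> D} \<le> exp ((\<rho> - 1) * card R * k / m * card S - D * ln \<rho>)"
    using R S \<rho> by (intro incidence_tail_bound k m) (auto simp: ksubsets_def)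
  also have "\<dots> \<le> exp (- (4 * s * (1 + ln z)))"
  proof -
    have "(\<rho> - 1) * card R * k / m * card S = D - r * k / m * s"
      using R S unfolding D\<rho> by (simp add: ksubsets_def r_def left_diff_distrib diff_divide_distrib)
    also have "\<dots> \<le> D" by (simp add: r_def)
    finally show ?thesis using main by (simp add: right_diff_distrib)
  qed
  finally show ?thesis by (simp add: D_def r_def z_def)
qed

lemma prob_not_spread_le:
  assumes k: "k \<le> m" and n: "1 \<le> n" "n \<le> m"
  shows "measure_pmf.prob (Pi_pmf {..<n} {} (\<lambda>_. pmf_of_set (ksubsets m k)))
      {E. \<not> spread_incidence m n k E} \<le> 1 / n"
proof (cases "k = 0")
  case True
  have "set_pmf (Pi_pmf {..<n} {} (\<lambda>_. pmf_of_set (ksubsets m k))) \<inter> {E. \<not> spread_incidence m n k E} = {}"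
  proof -
    have "spread_incidence m n k E" if "E \<in> set_pmf (Pi_pmf {..<n} {} (\<lambda>_. pmf_of_set (ksubsets m k)))" for E
    proof -
      have "E j = {}" if "j < n" for j
      proof -
        have "E j \<in> ksubsets m k"
          using that \<open>E \<in> _\<close> ksubsets_nonempty[OF k] by (auto simp: set_Pi_pmf PiE_dflt_def)
        then have "E j \<subseteq> {..<m}" "card (E j) = 0" using True by (auto simp: ksubsets_def)
        then show ?thesis using finite_subset[of "E j" "{..<m}"] by simp
      qed
      then have "card {j\<in>S. i \<in> E j} = 0" if "S \<subseteq> {..<n}" for S i
        using that by (metis (mono_tags, lifting) card.empty emptyE empty_Collect_eq lessThan_iff subsetD)
      then show ?thesis by (auto simp: spread_incidence_def True)
    qed
    then show ?thesis by auto
  qed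
  then have "measure_pmf.prob (Pi_pmf {..<n} {} (\<lambda>_. pmf_of_set (ksubsets m k)))
      {E. \<not> spread_incidence m n k E} = 0"
    by (simp add: measure_pmf_zero_iff)
  then show ?thesis by simp
next
  case False
  then have k1: "1 \<le> k" by simp
  let ?P = "Pi_pmf {..<n} {} (\<lambda>_. pmf_of_set (ksubsets m k))"
  define bad where "bad s S R =
    {E :: nat \<Rightarrow> nat set. real (\<Sum>j\<in>S. card (R \<inter> E j)) \<ge> real (s div 16 + 1) * (64 * (real k * s / m + sqrt k))}"
    for s S and R :: "nat set"
  have m: "0 < m" using n by simp
  have "{E. \<not> spread_incidence m n k E} \<subseteq>
      (\<Union>s\<in>{1..n}. \<Union>S\<in>ksubsets n s. \<Union>R\<in>ksubsets m (s div 16 + 1). bad s S R)"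
  proof
    fix E assume "E \<in> {E. \<not> spread_incidence m n k E}"
    then have "\<not> spread_incidence m n k E" by simp
    from this m obtain s S R where "1 \<le> s" "s \<le> n" "S \<in> ksubsets n s" "R \<in> ksubsets m (s div 16 + 1)"
      "real (\<Sum>j\<in>S. card (R \<inter> E j)) \<ge> real (s div 16 + 1) * (64 * (real k * s / m + sqrt k))"
      by (rule dense_pair_of_not_spread)
    then show "E \<in> (\<Union>s\<in>{1..n}. \<Union>S\<in>ksubsets n s. \<Union>R\<in>ksubsets m (s div 16 + 1). bad s S R)"
      unfolding bad_def by (intro UN_I[of s] UN_I[of S] UN_I[of R]) auto
  qed
  then have "measure_pmf.prob ?P {E. \<not> spread_incidence m n k E} \<le>
      measure_pmf.prob ?P (\<Union>s\<in>{1..n}. \<Union>S\<in>ksubsets n s. \<Union>R\<in>ksubsets m (s div 16 + 1). bad s S R)"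
    by (intro measure_pmf.finite_measure_mono) auto
  also have "\<dots> \<le> card {1..n} * (1 / m ^ 2)"
  proof (rule prob_UN_le_card_mult)
    fix s assume s: "s \<in> {1..n}"
    define L where "L = s * (1 + ln (real m / s))"
    have "measure_pmf.prob ?P (\<Union>S\<in>ksubsets n s. \<Union>R\<in>ksubsets m (s div 16 + 1). bad s S R) \<le>
        card (ksubsets n s) * (card (ksubsets m (s div 16 + 1)) * exp (- (4 * L)))"
    proof (intro prob_UN_le_card_mult finite_ksubsets)
      fix S R assume "S \<in> ksubsets n s" "R \<in> ksubsets m (s div 16 + 1)"
      from prob_dense_pair_le[OF k1 k _ _ n(2) this] s
      show "measure_pmf.prob ?P (bad s S R) \<le> exp (- (4 * L))"
        by (simp add: bad_def L_def mult.assoc)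
    qed
    also have "\<dots> \<le> exp L * (exp L * exp (- (4 * L)))"
      unfolding card_ksubsets L_def using s n
      by (intro mult_mono mult_right_mono binomial_le_exp) auto
    also have "\<dots> = exp (- (2 * L))" by (simp flip: exp_add)
    also have "\<dots> \<le> exp (- (2 * ln m))"
    proof -
      have z: "real m / s \<ge> 1" using s n by simp
      have "ln m = ln s + ln (real m / s)" using s m by (simp add: ln_div)
      also have "\<dots> \<le> s + s * ln (real m / s)"
      proof (rule add_mono)
        show "ln (real s) \<le> s" using s ln_le_minus_one[of "real s"] by simp
        show "ln (real m / s) \<le> s * ln (real m / s)"
          using s z mult_right_mono[of 1 "real s" "ln (real m / s)"] by simp
      qed
      also have "\<dots> = L" by (simp add: L_def distrib_left)
      finally show ?thesis by simp
    qed
    also have "\<dots> = 1 / m ^ 2"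
    proof -
      have "exp (2 * ln (real m)) = m ^ 2"
        using exp_of_nat_mult[of 2 "ln (real m)"] m by simp
      then show ?thesis by (simp add: exp_minus field_simps)
    qed
    finally show "measure_pmf.prob ?P (\<Union>S\<in>ksubsets n s. \<Union>R\<in>ksubsets m (s div 16 + 1). bad s S R) \<le> 1 / m ^ 2" .
  qed simp
  also have "\<dots> \<le> n * (1 / n ^ 2)"
    using n by (simp add: frac_le power_mono)
  also have "\<dots> = 1 / n" by (simp add: power2_eq_square)
  finally show ?thesis .
qed

section \<open>Adding a sparse matrix\<close>

lemma card_rows_large_sum_le:
  fixes \<gamma> :: "'r \<Rightarrow> 'c \<Rightarrow> real" and t :: nat
  assumes "finite R" "finite S"
    and \<gamma>: "\<And>i c. i \<in> R \<Longrightarrow> c \<in> S \<Longrightarrow> \<bar>\<gamma> i c\<bar> \<le> 1"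
    and t: "\<And>c. c \<in> S \<Longrightarrow> card {i\<in>R. \<gamma> i c \<noteq> 0} \<le> t"
  shows "16 * card {i\<in>R. (\<Sum>c\<in>S. \<bar>\<gamma> i c\<bar>) > 16 * real t} \<le> card S"
proof -
  define V where "V = {i\<in>R. (\<Sum>c\<in>S. \<bar>\<gamma> i c\<bar>) > 16 * real t}"
  have V: "finite V" "V \<subseteq> R" using assms(1) by (auto simp: V_def)
  have col: "(\<Sum>i\<in>R. \<bar>\<gamma> i c\<bar>) \<le> t" if c: "c \<in> S" for c
  proof -
    have "(\<Sum>i\<in>R. \<bar>\<gamma> i c\<bar>) = (\<Sum>i\<in>{i\<in>R. \<gamma> i c \<noteq> 0}. \<bar>\<gamma> i c\<bar>)"
      using assms(1) by (intro sum.mono_neutral_right) auto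
    also have "\<dots> \<le> real (card {i\<in>R. \<gamma> i c \<noteq> 0}) * 1"
      using \<gamma> c by (intro sum_bounded_above) auto
    finally show ?thesis using t[OF c] by linarith
  qed
  have "(\<Sum>i\<in>R. \<Sum>c\<in>S. \<bar>\<gamma> i c\<bar>) = (\<Sum>c\<in>S. \<Sum>i\<in>R. \<bar>\<gamma> i c\<bar>)" by (rule sum.swap)
  also have "\<dots> \<le> card S * real t" using col by (rule sum_bounded_above)
  finally have total: "(\<Sum>i\<in>R. \<Sum>c\<in>S. \<bar>\<gamma> i c\<bar>) \<le> card S * real t" .
  have "(\<Sum>i\<in>V. \<Sum>c\<in>S. \<bar>\<gamma> i c\<bar>) \<le> (\<Sum>i\<in>R. \<Sum>c\<in>S. \<bar>\<gamma> i c\<bar>)"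
    using assms(1) V by (intro sum_mono2) (auto intro: sum_nonneg)
  then have le: "(\<Sum>i\<in>V. \<Sum>c\<in>S. \<bar>\<gamma> i c\<bar>) \<le> card S * real t" using total by linarith
  show ?thesis
  proof (cases "V = {}")
    case True
    then show ?thesis unfolding V_def[symmetric] by simp
  next
    case False
    have "card V * (16 * real t) = (\<Sum>i\<in>V. 16 * real t)" by simp
    also have "\<dots> < (\<Sum>i\<in>V. \<Sum>c\<in>S. \<bar>\<gamma> i c\<bar>)"
      using False V by (intro sum_strict_mono) (auto simp: V_def)
    also note le
    finally have "real t * (16 * card V) < real t * card S" by (simp add: mult_ac)
    then have "real (16 * card V) < card S" by (simp add: mult_less_cancel_left)
    then show ?thesis unfolding V_def[symmetric] by linarith
  qed
qed

theorem spread_plus_sparse_coloring: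
  fixes \<rho> \<gamma> :: "'r \<Rightarrow> 'c \<Rightarrow> real" and k m t :: nat
  assumes fin: "finite N" "finite R" and R: "card R = m" and N: "card N = n" "2 \<le> n" "n \<le> m"
    and \<rho>: "\<And>i c. i \<in> R \<Longrightarrow> c \<in> N \<Longrightarrow> \<bar>\<rho> i c\<bar> \<le> 1"
    and spread: "\<And>S. S \<subseteq> N \<Longrightarrow>
      16 * card {i\<in>R. (\<Sum>c\<in>S. \<bar>\<rho> i c\<bar>) > 64 * (real k * card S / m + sqrt k)} \<le> card S"
    and \<gamma>: "\<And>i c. i \<in> R \<Longrightarrow> c \<in> N \<Longrightarrow> \<bar>\<gamma> i c\<bar> \<le> 1"
    and t: "\<And>c. c \<in> N \<Longrightarrow> card {i\<in>R. \<gamma> i c \<noteq> 0} \<le> t"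
  shows "\<exists>x. (\<forall>j\<in>N. \<bar>x j\<bar> = 1) \<and> (\<forall>i\<in>R. \<bar>lform N (\<rho> i) x\<bar> \<le> 816 * sqrt k) \<and>
           (\<forall>i\<in>R. \<bar>lform N (\<gamma> i) x\<bar> \<le> 640 * sqrt (t * ln n))"
proof -
  have m: "m > 0" and NR: "card N \<le> m" using N by auto
  have "ln 2 \<le> ln (real n)" using N by (intro ln_mono) auto
  then have ln: "ln (real n) \<ge> 2 / 3" using ln2_ge_two_thirds by linarith
  have big: "16 * card {i\<in>R. (\<Sum>c\<in>S. \<bar>\<gamma> i c\<bar>) > 16 * real t} \<le> card S" if "S \<subseteq> N" for S
    using fin \<gamma> t that by (intro card_rows_large_sum_le) (auto intro: finite_subset)
  \<comment> \<open>The potential needs the scaling \<open>sqrt (ln n / t)\<close> to be at most \<open>1 / 20\<close>. For smaller \<open>t\<close> the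
    Beck--Fiala bound \<open>32 t\<close> suffices, and for \<open>t \<ge> n ^ 2\<close> the trivial bound \<open>n\<close> does.\<close>
  consider "n ^ 2 \<le> t" | "real t < 400 * ln n" | "t < n ^ 2" "400 * ln n \<le> real t" by linarith
  then show ?thesis
  proof cases
    case 1
    have "\<exists>x. (\<forall>j\<in>N. \<bar>x j\<bar> = 1) \<and> (\<forall>e\<in>{}. item_ok N x e) \<and> (\<forall>g\<in>{}. blocker_ok N x g) \<and>
           (\<forall>i\<in>R. \<bar>lform N (\<rho> i) x\<bar> \<le> 816 * sqrt k)"
      by (rule spread_rows_coloring[OF fin(1) _ _ fin(2) R m NR]) (use \<rho> spread in auto)
    then obtain x where x: "\<forall>j\<in>N. \<bar>x j\<bar> = 1" "\<forall>i\<in>R. \<bar>lform N (\<rho> i) x\<bar> \<le> 816 * sqrt k" by blast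
    have "\<bar>lform N (\<gamma> i) x\<bar> \<le> 640 * sqrt (t * ln n)" if i: "i \<in> R" for i
    proof -
      have "\<bar>lform N (\<gamma> i) x\<bar> \<le> (\<Sum>c\<in>N. \<bar>\<gamma> i c * x c\<bar>)" unfolding lform_def by (rule sum_abs)
      also have "\<dots> \<le> real (card N) * 1"
        using \<gamma>[OF i] x(1) by (intro sum_bounded_above) (auto simp: abs_mult)
      also have "\<dots> = sqrt (real (n ^ 2))" using N by simp
      also have "\<dots> \<le> sqrt (640\<^sup>2 * (t * ln n))"
      proof (rule real_sqrt_le_mono)
        have "real (n ^ 2) * 1 \<le> real t * (640\<^sup>2 * ln n)"
          using 1 ln by (intro mult_mono) (auto simp only: of_nat_le_iff, auto)
        then show "real (n ^ 2) \<le> 640\<^sup>2 * (t * ln n)" by (simp add: mult_ac)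
      qed
      also have "\<dots> = 640 * sqrt (t * ln n)" by (subst real_sqrt_mult) simp
      finally show ?thesis .
    qed
    then show ?thesis using x by blast
  next
    case 2
    define G where "G = row_blockers R \<gamma> (\<lambda>_. 0) (16 * real t)"
    have "\<exists>x. (\<forall>j\<in>N. \<bar>x j\<bar> = 1) \<and> (\<forall>e\<in>{}. item_ok N x e) \<and> (\<forall>g\<in>G. blocker_ok N x g) \<and>
           (\<forall>i\<in>R. \<bar>lform N (\<rho> i) x\<bar> \<le> 816 * sqrt k)"
    proof (rule spread_rows_coloring[OF fin(1) _ _ fin(2) R m NR])
      fix S assume S: "S \<subseteq> N"
      have "card {g\<in>G. bheavy S g} \<le> card {i\<in>R. (\<Sum>c\<in>S. \<bar>\<gamma> i c\<bar>) > 16 * real t}"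
        unfolding G_def by (rule card_bheavy_row_blockers_le[OF fin(2)])
      then show "8 * (card {e\<in>{}. heavy S e} + card {g\<in>G. bheavy S g}) \<le> card S"
        using big[OF S] by simp
    qed (use \<rho> spread fin in \<open>auto simp: G_def row_blockers_def\<close>)
    then obtain x where x: "\<forall>j\<in>N. \<bar>x j\<bar> = 1" "\<forall>g\<in>G. blocker_ok N x g"
        "\<forall>i\<in>R. \<bar>lform N (\<rho> i) x\<bar> \<le> 816 * sqrt k" by blast
    have "\<bar>lform N (\<gamma> i) x\<bar> \<le> 640 * sqrt (t * ln n)" if i: "i \<in> R" for i
    proof -
      have "\<bar>lform N (\<gamma> i) x - 0\<bar> \<le> 2 * (16 * real t)"
        by (rule row_blockers_bound[where p = "\<lambda>_. 0" and R = R, OF _ i]) (use x in \<open>auto simp: G_def\<close>)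
      also have "real t \<le> sqrt (20\<^sup>2 * (t * ln n))"
      proof (rule real_le_rsqrt)
        have "real t * real t \<le> real t * (400 * ln n)" using 2 by (intro mult_left_mono) auto
        then show "(real t)\<^sup>2 \<le> 20\<^sup>2 * (t * ln n)" by (simp add: power2_eq_square mult_ac)
      qed
      also have "\<dots> = 20 * sqrt (t * ln n)" by (subst real_sqrt_mult) simp
      finally show ?thesis by simp
    qed
    then show ?thesis using x by blast
  next
    case 3
    define R' where "R' = {i\<in>R. \<exists>c\<in>N. \<gamma> i c \<noteq> 0}"
    define l where "l = sqrt (ln n / t)"
    define h where "h = l\<^sup>2 * (16 * real t)"
    define \<beta> where "\<beta> = 1 / (2 * real n ^ 3)"
    define b where "b = 87 * ln n"
    define E where "E = row_items R' \<gamma> l (\<lambda>_. 0) h \<beta> b"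
    have tpos: "0 < real t" using 3(2) ln by linarith
    have l: "0 < l" "l \<le> 1 / 20"
    proof -
      show "0 < l" using ln tpos by (simp add: l_def)
      have "ln n / t \<le> (1 / 20)\<^sup>2" using 3(2) tpos by (simp add: power2_eq_square pos_divide_le_eq)
      then show "l \<le> 1 / 20" unfolding l_def by (intro real_le_lsqrt) auto
    qed
    have h: "h = 16 * ln n" using tpos ln by (simp add: h_def l_def)
    have \<beta>: "\<beta> > 0" using N by (simp add: \<beta>_def)
    have b: "b \<ge> 0" using ln by (simp add: b_def)
    have finR': "finite R'" "R' \<subseteq> R" using fin by (auto simp: R'_def)
    have "card R' \<le> n ^ 3"
    proof -
      have "R' = (\<Union>c\<in>N. {i\<in>R. \<gamma> i c \<noteq> 0})" by (auto simp: R'_def)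
      then have "card R' \<le> (\<Sum>c\<in>N. card {i\<in>R. \<gamma> i c \<noteq> 0})" using card_UN_le[OF fin(1)] by simp
      also have "\<dots> \<le> card N * t" using t by (intro sum_bounded_above[where 'a = nat, simplified]) auto
      also have "\<dots> \<le> n * n ^ 2" using 3(1) N by (intro mult_le_mono) auto
      finally show ?thesis by (simp add: power_numeral_reduce)
    qed
    then have cR': "real (card R') \<le> real n ^ 3" by (metis of_nat_le_iff of_nat_power)
    have adm: "admissible N e" if "e \<in> E" for e
      by (rule admissible_row_items[OF less_imp_le[OF \<beta>] b l _ that[unfolded E_def]])
        (use \<gamma> finR' in auto)
    have "\<exists>x. (\<forall>j\<in>N. \<bar>x j\<bar> = 1) \<and> (\<forall>e\<in>E. item_ok N x e) \<and> (\<forall>g\<in>{}. blocker_ok N x g) \<and>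
           (\<forall>i\<in>R. \<bar>lform N (\<rho> i) x\<bar> \<le> 816 * sqrt k)"
    proof (rule spread_rows_coloring[OF fin(1) _ _ fin(2) R m NR _ _ adm])
      show "finite E" using finR' by (simp add: E_def)
      have "(\<Sum>e\<in>E. wt e) \<le> 2 * card R' * \<beta>"
        unfolding E_def using finR' \<beta> by (intro sum_wt_row_items_le) auto
      also have "\<dots> = card R' / real n ^ 3" by (simp add: \<beta>_def)
      also have "\<dots> \<le> 1" using cR' N by simp
      finally show "(\<Sum>e\<in>E. wt e) \<le> 1" .
    next
      fix e assume "e \<in> E"
      then have e: "wt e = \<beta>" "bnd e = b" "thr e = h" by (auto simp: E_def row_items_def)
      have "exp (b - 5 * h) = real n ^ 7"
        using exp_of_nat_mult[of 7 "ln (real n)"] N by (simp add: b_def h)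
      also have "\<dots> = real n ^ 4 * real n ^ 3" by (simp flip: power_add)
      finally have "wt e * exp (bnd e - 5 * thr e) = \<beta> * real n ^ 3 * real n ^ 4" by (simp only: e mult_ac)
      also have "\<beta> * real n ^ 3 = 1 / 2" using N by (simp add: \<beta>_def)
      finally have "wt e * exp (bnd e - 5 * thr e) = 1 / 2 * real n ^ 4" .
      moreover have "2 ^ 4 \<le> real n ^ 4" using N by (intro power_mono) auto
      ultimately show "wt e * exp (bnd e - 5 * thr e) > 4" by simp
    next
      fix S assume S: "S \<subseteq> N"
      have "card {e\<in>E. heavy S e} \<le> 2 * card {i\<in>R'. (\<Sum>c\<in>S. \<bar>\<gamma> i c\<bar>) > 16 * real t}"
        unfolding E_def using \<gamma> finR' S by (intro card_heavy_row_items_le l h_def) auto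
      also have "card {i\<in>R'. (\<Sum>c\<in>S. \<bar>\<gamma> i c\<bar>) > 16 * real t} \<le> card {i\<in>R. (\<Sum>c\<in>S. \<bar>\<gamma> i c\<bar>) > 16 * real t}"
        using fin finR' by (intro card_mono) auto
      finally show "8 * (card {e\<in>E. heavy S e} + card {g\<in>{}. bheavy S g}) \<le> card S"
        using big[OF S] by simp
    qed (use \<rho> spread in \<open>auto simp: E_def row_items_def\<close>)
    then obtain x where x: "\<forall>j\<in>N. \<bar>x j\<bar> = 1" "\<forall>e\<in>E. item_ok N x e"
        "\<forall>i\<in>R. \<bar>lform N (\<rho> i) x\<bar> \<le> 816 * sqrt k" by blast
    have "\<bar>lform N (\<gamma> i) x\<bar> \<le> 640 * sqrt (t * ln n)" if i: "i \<in> R" for i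
    proof (cases "i \<in> R'")
      case True
      have "\<bar>lform N (\<gamma> i) x - 0\<bar> \<le> b / l"
        by (rule row_items_bound[where p = "\<lambda>_. 0" and R = R', OF l(1) b True])
          (use x in \<open>auto simp: E_def\<close>)
      also have "\<dots> = 87 * (ln n / l)" by (simp add: b_def)
      also have "ln n / l = sqrt (t * ln n)"
      proof -
        have "sqrt (t * ln n) * l = sqrt (t * ln n * (ln n / t))" by (simp only: l_def real_sqrt_mult)
        also have "\<dots> = ln n" using tpos ln by simp
        finally show ?thesis using l(1) by (simp add: field_simps)
      qed
      also have "87 * sqrt (t * ln n) \<le> 640 * sqrt (t * ln n)" using ln by (intro mult_right_mono) auto
      finally show ?thesis by simp
    next
      case False
      then have "lform N (\<gamma> i) x = 0" using i by (simp add: lform_def R'_def)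
      then show ?thesis using ln by simp
    qed
    then show ?thesis using x by blast
  qed
qed

lemma disc_le:
  assumes B: "B \<in> carrier_mat m n" and x: "\<forall>j<n. \<bar>x j\<bar> = (1::real)" and "0 \<le> b"
    and row: "\<And>i. i < m \<Longrightarrow> \<bar>\<Sum>j<n. B $$ (i, j) * x j\<bar> \<le> b"
  shows "disc B \<le> b"
proof -
  define v where "v = vec n x"
  have "v \<in> sign_vecs n"
    using x by (auto simp: v_def sign_vecs_def vec_set_def abs_if split: if_splits)
  then have "disc B \<le> linf_norm_vec (B *\<^sub>v v)"
    unfolding disc_def using B by (intro Min_le finite_imageI finite_sign_vecs) auto
  also have "\<dots> \<le> b"
  proof -
    have "\<bar>(B *\<^sub>v v) $ i\<bar> \<le> b" if "i < m" for i
      using row[OF that] that B by (simp add: v_def scalar_prod_def atLeast0LessThan)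
    then show ?thesis
      unfolding linf_norm_vec_def using B assms(3)
      by (subst Max_le_iff) (auto simp: vec_set_def)
  qed
  finally show ?thesis .
qed

lemma disc_incidence_plus_sparse_le:
  fixes C :: "real mat" and t :: nat
  assumes n: "2 \<le> n" "n \<le> m" and E: "spread_incidence m n k E"
    and C: "C \<in> carrier_mat m n" "elements_mat C \<subseteq> {-1, 0, 1}" "\<forall>j<n. col_nonzeros C j \<le> t"
  shows "disc (Matrix.mat m n (\<lambda>(i, j). of_bool (i \<in> E j)) + C)
           \<le> 816 * (sqrt (real k) + sqrt (real t * ln (real n)))"
proof -
  define \<rho> where "\<rho> i j = (of_bool (i \<in> E j) :: real)" for i j
  have "\<exists>x. (\<forall>j\<in>{..<n}. \<bar>x j\<bar> = 1) \<and> (\<forall>i\<in>{..<m}. \<bar>lform {..<n} (\<rho> i) x\<bar> \<le> 816 * sqrt k) \<and>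
           (\<forall>i\<in>{..<m}. \<bar>lform {..<n} (\<lambda>j. C $$ (i, j)) x\<bar> \<le> 640 * sqrt (t * ln n))"
  proof (rule spread_plus_sparse_coloring)
    fix S assume S: "S \<subseteq> {..<n}"
    then have "finite S" using finite_subset by blast
    then have "(\<Sum>c\<in>S. \<bar>\<rho> i c\<bar>) = card {j\<in>S. i \<in> E j}" for i
      by (simp add: \<rho>_def Int_def)
    then show "16 * card {i\<in>{..<m}. (\<Sum>c\<in>S. \<bar>\<rho> i c\<bar>) > 64 * (real k * card S / m + sqrt k)} \<le> card S"
      using E S by (simp add: spread_incidence_def)
  next
    fix i c assume "i \<in> {..<m}" "c \<in> {..<n}"
    then have "C $$ (i, c) \<in> {-1, 0, 1}" using C by blast
    then show "\<bar>C $$ (i, c)\<bar> \<le> 1" by auto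
  next
    fix c assume "c \<in> {..<n}"
    then show "card {i\<in>{..<m}. C $$ (i, c) \<noteq> 0} \<le> t" using C by (auto simp: col_nonzeros_def)
  qed (use n in \<open>auto simp: \<rho>_def\<close>)
  then obtain x where x: "\<forall>j<n. \<bar>x j\<bar> = 1" "\<forall>i<m. \<bar>lform {..<n} (\<rho> i) x\<bar> \<le> 816 * sqrt k"
      "\<forall>i<m. \<bar>lform {..<n} (\<lambda>j. C $$ (i, j)) x\<bar> \<le> 640 * sqrt (t * ln n)"
    by auto
  have s0: "0 \<le> sqrt (t * ln n)" using n by simp
  show ?thesis
  proof (rule disc_le[OF _ x(1)])
    show "Matrix.mat m n (\<lambda>(i, j). of_bool (i \<in> E j)) + C \<in> carrier_mat m n" using C by simp
    show "0 \<le> 816 * (sqrt (real k) + sqrt (real t * ln (real n)))" using s0 by simp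
    fix i assume i: "i < m"
    have "(\<Sum>j<n. (Matrix.mat m n (\<lambda>(i, j). of_bool (i \<in> E j)) + C) $$ (i, j) * x j) =
        lform {..<n} (\<rho> i) x + lform {..<n} (\<lambda>j. C $$ (i, j)) x"
      unfolding lform_def sum.distrib[symmetric]
      using i C by (intro sum.cong) (auto simp: \<rho>_def distrib_right)
    moreover have "\<bar>lform {..<n} (\<rho> i) x\<bar> \<le> 816 * sqrt k"
        "\<bar>lform {..<n} (\<lambda>j. C $$ (i, j)) x\<bar> \<le> 640 * sqrt (t * ln n)"
      using x(2,3) i by auto
    ultimately show "\<bar>\<Sum>j<n. (Matrix.mat m n (\<lambda>(i, j). of_bool (i \<in> E j)) + C) $$ (i, j) * x j\<bar>
        \<le> 816 * (sqrt (real k) + sqrt (real t * ln (real n)))"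
      using s0 unfolding distrib_left by linarith
  qed
qed

theorem theorem7:
  shows "\<exists>K c :: real. K > 0 \<and> c > 0 \<and>
    (\<forall>(n::nat) (m::nat) (k::nat) (t::nat) (C :: real mat).
       1 \<le> n \<longrightarrow> n \<le> m \<longrightarrow> k \<le> m \<longrightarrow>
       C \<in> carrier_mat m n \<longrightarrow>
       elements_mat C \<subseteq> {-1, 0, 1} \<longrightarrow>
       (\<forall>j<n. col_nonzeros C j \<le> t) \<longrightarrow>
       measure_pmf.prob (random_regular_incidence m n k)
         {A. disc (A + C) \<le> K * (sqrt (real k) + sqrt (real t * ln (real n)))}
         \<ge> 1 - real n powr (- c))"
proof (rule exI[of _ 816], rule exI[of _ 1], intro conjI allI impI)
  fix n m k t :: nat and C :: "real mat"
  assume n: "1 \<le> n" "n \<le> m" and k: "k \<le> m" and C: "C \<in> carrier_mat m n"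
    "elements_mat C \<subseteq> {-1, 0, 1}" "\<forall>j<n. col_nonzeros C j \<le> t"
  define P where "P = Pi_pmf {..<n} {} (\<lambda>_. pmf_of_set (ksubsets m k))"
  define inc where "inc E = Matrix.mat m n (\<lambda>(i, j). of_bool (i \<in> E j) :: real)" for E :: "nat \<Rightarrow> nat set"
  define good where "good = {A. disc (A + C) \<le> 816 * (sqrt (real k) + sqrt (real t * ln (real n)))}"
  have law: "random_regular_incidence m n k = map_pmf inc P"
    by (simp add: random_regular_incidence_def P_def inc_def[abs_def] ksubsets_def)
  have "1 - real n powr - 1 \<le> measure_pmf.prob (map_pmf inc P) good"
  proof (cases "n = 1")
    case True
    then show ?thesis by simp
  next
    case False
    have "1 - real n powr - 1 = 1 - 1 / n" using n by (simp add: powr_minus_divide)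
    also have "\<dots> \<le> 1 - measure_pmf.prob P {E. \<not> spread_incidence m n k E}"
      using prob_not_spread_le[OF k n] by (simp add: P_def)
    also have "\<dots> = measure_pmf.prob P {E. spread_incidence m n k E}"
    proof -
      have "{E. \<not> spread_incidence m n k E} = UNIV - {E. spread_incidence m n k E}" by auto
      then show ?thesis using measure_pmf.prob_compl[of "{E. spread_incidence m n k E}" P] by simp
    qed
    also have "\<dots> \<le> measure_pmf.prob P (inc -` good)"
    proof (rule measure_pmf.finite_measure_mono)
      show "{E. spread_incidence m n k E} \<subseteq> inc -` good"
        using disc_incidence_plus_sparse_le[OF _ n(2) _ C] n(1) False by (auto simp: good_def inc_def)
    qed simp
    also have "\<dots> = measure_pmf.prob (map_pmf inc P) good" by simp
    finally show ?thesis .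
  qed
  then show "1 - real n powr - 1 \<le> measure_pmf.prob (random_regular_incidence m n k)
      {A. disc (A + C) \<le> 816 * (sqrt (real k) + sqrt (real t * ln (real n)))}"
    by (simp only: law good_def)
qed simp_all

end
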